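(* Assume conditions (C1), (N2), (C2), (C3) and (C4) of the context. Then, for $\Delta t$ sufficiently small, the solution $u_h^n\in V_h^n$, $n=1,\dots,N$, of the fully discrete method (FD) of the context with initial value $u_h^0\in V_h^0$ satisfies $$\|u_h^n\|_{\Gamma_h^n}^2+\sum_{k=1}^n\Delta t\Big(2\nu\|\nabla_{\Gamma_h}u_h^k\|_{\Gamma_h^k}^2+\rho_k\|\mathbf n_h^k\cdot\nabla u_h^k\|_{\mathcal O(\Gamma_h^k)}^2\Big)\le\frac32\exp(c\,t_n)\Big(\|u_h^0\|_{\Gamma_h^0}^2+\tilde\rho_0\|\mathbf n_h^0\cdot\nabla u_h^0\|_{\mathcal O(\Gamma_h^0)}^2\Big),$$ with $c$ independent of $h$, $\Delta t$ and $n$, and $\tilde\rho_0=c_b\,\delta_0(\delta_0+h)^{-1}$, where $c_b$ is the constant in (C4).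
   Context: **Surface.** $\Omega\subset\mathbb R^3$ is a fixed domain, $T>0$, $\mathbf w=\mathbf w(\mathbf x,t)$ a smooth velocity field, $\nu>0$ a constant. For $t\in[0,T]$, $\Gamma(t)\subset\Omega$ is a smooth, closed, connected, oriented hypersurface with unit normal $\mathbf n$, evolving smoothly, with normal velocity $w_N:=\mathbf w\cdot\mathbf n$; on $\Gamma(t)$, $\mathbf w=\mathbf w_T+w_N\mathbf n$ with $\mathbf w_T$ tangential. $\mathcal G=\bigcup_{t\in(0,T)}\Gamma(t)\times\{t\}\subset\mathbb R^4$, and $\mathcal O(\mathcal G)$ is a neighborhood of $\mathcal G$ with time sections $\mathcal O(\Gamma(t))$. $\Gamma(t)$ is the zero level of a smooth level set function $\phi(\cdot,t)$ which is the signed distance function to $\Gamma(t)$ in $\mathcal O(\Gamma(t))$. $\mathbf p(\cdot,t):\mathcal O(\Gamma(t))\to\Gamma(t)$ is the closest point projection. **Time grid and norms.** $\Delta t=T/N$, $t_n=n\Delta t$, $I_n=[t_{n-1},t_n)$, $\Gamma^n=\Gamma(t_n)$, $\mathbf p^n=\mathbf p(\cdot,t_n)$. $\|\cdot\|_G$ is the $L^2(G)$ norm, $\|\cdot\|_{\infty,G}$ the $L^\infty(G)$ norm, $\|v\|_{\infty,I_n}=\sup_{t\in I_n}\|v\|_{\infty,\Gamma(t)}$; for $n=0$, $\|w_N\|_{\infty,I_0}$ is read as $\|w_N\|_{\infty,\Gamma(0)}$. $x\lesssim y$ means $x\le Cy$ with $C$ independent of $h$, $\Delta t$, $n$ and the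 position of the surface over the background mesh. **Mesh and discrete surfaces.** $\{\mathcal T_h\}_{h>0}$ is a quasi-uniform, shape regular family of consistent tetrahedral triangulations of $\Omega$ with maximal element diameter at most $h$. $\phi_h(\cdot,t)$ is a continuous piecewise polynomial (w.r.t. $\mathcal T_h$) approximation of $\phi$, $\nabla\phi_h\ne0$ near $\Gamma(t)$, $\phi_h^n=\phi_h(\cdot,t_n)$, such that for some $q\ge1$: $\|\phi-\phi_h\|_{\infty,\Omega}+h\|\nabla(\phi-\phi_h)\|_{\infty,\Omega}\lesssim h^{q+1}$ for all $t\in[0,T]$; and for $n=1,\dots,N$, $\|\phi_h^{n-1}-\phi_h^n\|_{\infty,\Omega}\lesssim\Delta t\|w_N\|_{\infty,I_n}$ and $\|\nabla\phi_h^{n-1}-\nabla\phi_h^n\|_{\infty,\Omega}\lesssim\Delta t(\|w_N\|_{\infty,I_n}+\|\nabla w_N\|_{\infty,I_n})$. $\Gamma_h^n=\{\phi_h^n=0\}$, $\mathbf n_h^n=\nabla\phi_h^n/|\nabla\phi_h^n|$. $\delta_n:=c_\delta\|w_N\|_{\infty,I_n}\Delta t$ with a mesh-independent constant $c_\delta\ge1$. $U_{\delta_n}(\Gamma_h^n)=\{|\phi_h^n|<\delta_n\}$. $\mathcal S(\Gamma_h^n)=\{S\in\mathcal T_h:|\phi_h^n(\mathbf x)|\le\delta_n\text{ for some }\mathbf x\in S\}$, and $\mathcal O(\Gamma_h^n)$ is the interior of $\bigcup_{S\in\mathcal S(\Gamma_h^n)}\overline S$. $\mathcal O_\Gamma(\Gamma_h^n)$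 is the interior of the union of the closed tetrahedra $S$ for which $S\cap\Gamma_h^n$ has positive two-dimensional Hausdorff measure. It is assumed throughout that $\mathcal O(\Gamma_h^n)\subset\mathcal O(\Gamma^n)$ and $\mathcal O_\Gamma(\Gamma_h^{n+1})\subset\mathcal O(\Gamma^n)$. $V_h^n=\{v\in C(\mathcal O(\Gamma_h^n)):v|_S\in P_m(S)\ \forall S\in\mathcal S(\Gamma_h^n)\}$, $m\ge1$. **Method (FD).** With $\mathbf w^e=\mathbf w\circ\mathbf p^n$, $\mathbf w_T^e=\mathbf w_T\circ\mathbf p^n$ and parameters $\rho_n>0$, set $$a_n(u,v)=\int_{\Gamma_h^n}\Big(\tfrac12(\mathbf w_T^e\cdot\nabla_{\Gamma_h}u)v-\tfrac12(\mathbf w_T^e\cdot\nabla_{\Gamma_h}v)u+\operatorname{div}_{\Gamma_h}(\mathbf w^e-\tfrac12\mathbf w_T^e)uv\Big)ds_h+\nu\int_{\Gamma_h^n}\nabla_{\Gamma_h}u\cdot\nabla_{\Gamma_h}v\,ds_h+\rho_n\int_{\mathcal O(\Gamma_h^n)}(\mathbf n_h^n\cdot\nabla u)(\mathbf n_h^n\cdot\nabla v)\,d\mathbf x.$$ Given $u_h^0\in V_h^0$, find $u_h^n\in V_h^n$, $n=1,\dots,N$, with $\int_{\Gamma_h^n}\frac{u_h^n-u_h^{n-1}}{\Delta t}v_h\,ds_h+a_n(u_h^n,v_h)=0$ for all $v_h\in V_h^n$. **Conditions.** (C1) $\Delta t\le c_{\mathbf l}(c_\delta\|w_N\|_{\infty,I_n})^{-1}$,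 $n=1,\dots,N$, with $c_{\mathbf l}$ sufficiently small, independent of $h,\Delta t,n$. (N2) $c_\delta$ is sufficiently large that $\Gamma_h^n\subset U_{\delta_{n-1}}(\Gamma_h^{n-1})$ and $\mathcal O_\Gamma(\Gamma_h^n)\subset\mathcal O(\Gamma_h^{n-1})$, $n=1,\dots,N$. (C2) $h^{2q}\le c_h\Delta t$ with $c_h$ independent of $\Delta t$, $h$. (C3) $\Delta t\le(4\xi_h)^{-1}$, $\xi_h:=\max_{n=0,\dots,N}\|\operatorname{div}_{\Gamma_h}(\mathbf w^e-\frac12\mathbf w_T^e)\|_{\infty,\Gamma_h^n}$. (C4) $\rho_n\ge c_\delta c_b\|w_N\|_{\infty,I_n}(\delta_n+h)^{-1}$, where $c_a,c_b$ are constants independent of $h,\Delta t,n$ for which, for all $v_h\in V_h^{n-1}$ and $n=1,\dots,N$, $\|v_h\|_{\Gamma_h^n}^2\le(1+c_a\Delta t)\|v_h\|_{\Gamma_h^{n-1}}^2+c_b\,\delta_{n-1}(\delta_{n-1}+h)^{-1}\|\mathbf n_h^{n-1}\cdot\nabla v_h\|_{\mathcal O(\Gamma_h^{n-1})}^2$. *)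

theory Defs
  imports "HOL-Probability.Essential_Supremum"
begin

type_synonym point = "real^3"


text \<open>Two-dimensional Hausdorff measure, normalised so that it agrees with area on planes:
  \<open>pi / 4 * d^2\<close> is the area of a disc of diameter \<open>d\<close>.\<close>

definition hausdorff2_pre :: "real \<Rightarrow> 'a::metric_space set \<Rightarrow> ennreal" where
  "hausdorff2_pre d A =
     (INF U\<in>{U :: nat \<Rightarrow> 'a set. A \<subseteq> (\<Union>i. U i) \<and> (\<forall>i. bounded (U i) \<and> diameter (U i) \<le> d)}.
        \<Sum>i. ennreal (pi / 4 * diameter (U i) ^ 2))"

definition hausdorff2_outer :: "'a::metric_space set \<Rightarrow> ennreal" where
  "hausdorff2_outer A = (SUP d\<in>{0<..}. hausdorff2_pre d A)"

definition hausdorff2 :: "'a::metric_space measure" where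
  "hausdorff2 = measure_of UNIV (sets borel) hausdorff2_outer"

text \<open>The set function is a metric outer measure, hence a measure on the Borel sets.\<close>

lemma hausdorff2_pre_le:
  assumes "A \<subseteq> (\<Union>i. U i)" "\<And>i. bounded (U i)" "\<And>i. diameter (U i) \<le> d"
  shows "hausdorff2_pre d A \<le> (\<Sum>i. ennreal (pi / 4 * diameter (U i) ^ 2))"
  unfolding hausdorff2_pre_def by (rule INF_lower) (use assms in auto)

lemma hausdorff2_pre_mono: "A \<subseteq> B \<Longrightarrow> hausdorff2_pre d A \<le> hausdorff2_pre d B"
  unfolding hausdorff2_pre_def by (rule INF_superset_mono) auto

lemma hausdorff2_pre_close:
  assumes "hausdorff2_pre d A < e"
  shows "\<exists>U. A \<subseteq> (\<Union>i. U i) \<and> (\<forall>i. bounded (U i) \<and> diameter (U i) \<le> d) \<and>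
    (\<Sum>i. ennreal (pi / 4 * diameter (U i) ^ 2)) < e"
  using assms unfolding hausdorff2_pre_def INF_less_iff by auto

lemma hausdorff2_pre_UN:
  fixes A :: "nat \<Rightarrow> 'a::metric_space set"
  shows "hausdorff2_pre d (\<Union>i. A i) \<le> (\<Sum>n. hausdorff2_pre d (A n))"
proof (rule ennreal_le_epsilon)
  fix e :: real
  let ?f = "\<lambda>U::'a set. ennreal (pi / 4 * diameter U ^ 2)"
  assume e: "0 < e" and fin: "(\<Sum>n. hausdorff2_pre d (A n)) < top"
  then have "\<And>n. hausdorff2_pre d (A n) < hausdorff2_pre d (A n) + e * (1/2)^Suc n"
    by (auto simp add: less_top dest!: ennreal_suminf_lessD)
  from hausdorff2_pre_close[OF this]
  have "\<forall>n. \<exists>U. A n \<subseteq> (\<Union>i. U i) \<and> (\<forall>i. bounded (U i) \<and> diameter (U i) \<le> d) \<and>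
    (\<Sum>i. ?f (U i)) < hausdorff2_pre d (A n) + e * (1/2)^Suc n" by blast
  then obtain B where B: "\<And>n. A n \<subseteq> (\<Union>i. B n i)" "\<And>n i. bounded (B n i)" "\<And>n i. diameter (B n i) \<le> d"
    and Ble: "\<And>n. (\<Sum>i. ?f (B n i)) \<le> hausdorff2_pre d (A n) + e * (1/2)^Suc n"
    by (metis less_imp_le)
  define C where "C = case_prod B \<circ> prod_decode"
  have AC: "(\<Union>i. A i) \<subseteq> (\<Union>i. C i)"
    using B(1) by (auto simp add: C_def subset_eq) (metis prod.case prod_encode_inverse)
  have "hausdorff2_pre d (\<Union>i. A i) \<le> (\<Sum>i. ?f (C i))"
    by (rule hausdorff2_pre_le[OF AC]) (use B in \<open>auto simp: C_def split: prod.splits\<close>)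
  also have "\<dots> = (\<Sum>i. (\<lambda>p. ?f (case_prod B p)) (prod_decode i))"
    by (simp add: C_def)
  also have "\<dots> = (\<Sum>n. \<Sum>i. ?f (B n i))"
    by (intro suminf_ennreal_2dimen) auto
  also have "\<dots> \<le> (\<Sum>n. hausdorff2_pre d (A n) + e * (1/2) ^ Suc n)"
    by (intro suminf_le allI Ble) auto
  also have "\<dots> = (\<Sum>n. hausdorff2_pre d (A n)) + (\<Sum>n. ennreal e * ennreal ((1/2) ^ Suc n))"
    using e by (subst suminf_add[symmetric])
      (auto simp del: ennreal_suminf_cmult simp add: ennreal_mult[symmetric])
  also have "\<dots> = (\<Sum>n. hausdorff2_pre d (A n)) + e"
    unfolding ennreal_suminf_cmult
    by (subst suminf_ennreal_eq[OF zero_le_power power_half_series]) auto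
  finally show "hausdorff2_pre d (\<Union>i. A i) \<le> (\<Sum>n. hausdorff2_pre d (A n)) + e" .
qed

lemma hausdorff2_pre_le_outer: "0 < d \<Longrightarrow> hausdorff2_pre d A \<le> hausdorff2_outer A"
  unfolding hausdorff2_outer_def by (rule SUP_upper) auto

lemma hausdorff2_outer_mono: "A \<subseteq> B \<Longrightarrow> hausdorff2_outer A \<le> hausdorff2_outer B"
  unfolding hausdorff2_outer_def by (rule SUP_mono) (auto intro: hausdorff2_pre_mono)

lemma hausdorff2_outer_empty: "hausdorff2_outer {} = 0"
proof -
  have "hausdorff2_pre d {} \<le> 0" if "0 < d" for d :: real
    using hausdorff2_pre_le[of "{}" "\<lambda>_. {}" d] that by simp
  then show ?thesis
    unfolding hausdorff2_outer_def by (intro antisym SUP_least) auto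
qed

lemma hausdorff2_outer_UN:
  "hausdorff2_outer (\<Union>i::nat. A i) \<le> (\<Sum>i. hausdorff2_outer (A i))"
proof -
  have "hausdorff2_pre d (\<Union>i. A i) \<le> (\<Sum>i. hausdorff2_outer (A i))" if "0 < d" for d
    by (rule order_trans[OF hausdorff2_pre_UN])
      (intro suminf_le allI hausdorff2_pre_le_outer that summableI)
  then show ?thesis
    unfolding hausdorff2_outer_def[of "\<Union>i. A i"] by (intro SUP_least) auto
qed

lemma outer_measure_space_hausdorff2: "outer_measure_space UNIV hausdorff2_outer"
  by (auto simp: outer_measure_space_def positive_def increasing_def countably_subadditive_def
      hausdorff2_outer_empty intro: hausdorff2_outer_mono hausdorff2_outer_UN)

lemma hausdorff2_outer_Un: "hausdorff2_outer (A \<union> B) \<le> hausdorff2_outer A + hausdorff2_outer B"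
proof -
  have "subadditive UNIV (hausdorff2_outer :: 'a set \<Rightarrow> ennreal)"
    by (metis ring_of_sets.countably_subadditive_subadditive Pow_UNIV ring_of_sets_Pow
        outer_measure_space_def outer_measure_space_hausdorff2)
  have "A \<union> B = A \<union> (B - A)" by auto
  then show ?thesis
    using subadditiveD[OF \<open>subadditive UNIV _\<close>, of A "B - A"] hausdorff2_outer_mono[of "B - A" B]
    by (metis Diff_disjoint UNIV_I add_left_mono order_trans Diff_subset)
qed

lemma hausdorff2_outer_separated:
  assumes r: "r > 0" "\<And>a b. a \<in> A \<Longrightarrow> b \<in> B \<Longrightarrow> r \<le> dist a b"
  shows "hausdorff2_outer A + hausdorff2_outer B \<le> hausdorff2_outer (A \<union> B)"
proof -
  let ?f = "\<lambda>U::'a set. ennreal (pi / 4 * diameter U ^ 2)"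
  have pre: "hausdorff2_pre d A + hausdorff2_pre d B \<le> hausdorff2_pre d (A \<union> B)" if "d < r" for d
    unfolding hausdorff2_pre_def[of d "A \<union> B"]
  proof (rule INF_greatest)
    fix U assume "U \<in> {U. A \<union> B \<subseteq> (\<Union>i::nat. U i) \<and> (\<forall>i. bounded (U i) \<and> diameter (U i) \<le> d)}"
    then have U: "A \<union> B \<subseteq> (\<Union>i. U i)" "\<And>i. bounded (U i)" "\<And>i. diameter (U i) \<le> d" by auto
    have d0: "0 \<le> d" using diameter_ge_0[OF U(2)] U(3) order_trans by blast
    define V where "V i = (if U i \<inter> A = {} then {} else U i)" for i
    define W where "W i = (if U i \<inter> B = {} then {} else U i)" for i
    have VW: "A \<subseteq> (\<Union>i. V i)" "B \<subseteq> (\<Union>i. W i)"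
      using U(1) by (fastforce simp: V_def W_def)+
    have "hausdorff2_pre d A \<le> (\<Sum>i. ?f (V i))"
      by (rule hausdorff2_pre_le[OF VW(1)]) (use U d0 in \<open>auto simp: V_def\<close>)
    moreover have "hausdorff2_pre d B \<le> (\<Sum>i. ?f (W i))"
      by (rule hausdorff2_pre_le[OF VW(2)]) (use U d0 in \<open>auto simp: W_def\<close>)
    ultimately have "hausdorff2_pre d A + hausdorff2_pre d B \<le> (\<Sum>i. ?f (V i)) + (\<Sum>i. ?f (W i))"
      by (rule add_mono)
    also have "\<dots> = (\<Sum>i. ?f (V i) + ?f (W i))" by (rule suminf_add) auto
    also have "\<dots> \<le> (\<Sum>i. ?f (U i))"
    proof (rule suminf_le)
      fix i
      have "U i \<inter> A = {} \<or> U i \<inter> B = {}"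
      proof (rule ccontr)
        assume "\<not> ?thesis"
        then obtain a b where "a \<in> U i" "a \<in> A" "b \<in> U i" "b \<in> B" by auto
        then show False
          using diameter_bounded_bound[OF U(2), of a i b] U(3)[of i] r(2)[of a b] that by force
      qed
      then show "?f (V i) + ?f (W i) \<le> ?f (U i)" by (auto simp: V_def W_def)
    qed auto
    finally show "hausdorff2_pre d A + hausdorff2_pre d B \<le> (\<Sum>i. ?f (U i))" .
  qed
  have anti: "hausdorff2_pre d' X \<le> hausdorff2_pre d X" if "d \<le> d'" for d d' and X :: "'a set"
    unfolding hausdorff2_pre_def using that by (intro INF_superset_mono) (auto intro: order_trans)
  have "hausdorff2_outer A + hausdorff2_outer B
      = (SUP d\<in>{0<..}. hausdorff2_pre d A + hausdorff2_pre d B)"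
    unfolding hausdorff2_outer_def
  proof (rule SUP_add_directed_ennreal[symmetric])
    fix i j :: real assume "i \<in> {0<..}" "j \<in> {0<..}"
    then show "\<exists>k\<in>{0<..}. hausdorff2_pre i A + hausdorff2_pre j B \<le> hausdorff2_pre k A + hausdorff2_pre k B"
      by (intro bexI[of _ "min i j"]) (auto intro!: add_mono anti)
  qed
  also have "\<dots> \<le> hausdorff2_outer (A \<union> B)"
  proof (rule SUP_least)
    fix d :: real assume d: "d \<in> {0<..}"
    have "hausdorff2_pre d A + hausdorff2_pre d B
        \<le> hausdorff2_pre (min d (r/2)) A + hausdorff2_pre (min d (r/2)) B"
      by (intro add_mono anti) auto
    also have "\<dots> \<le> hausdorff2_pre (min d (r/2)) (A \<union> B)" using r by (intro pre) auto
    also have "\<dots> \<le> hausdorff2_outer (A \<union> B)" using r d by (intro hausdorff2_pre_le_outer) auto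
    finally show "hausdorff2_pre d A + hausdorff2_pre d B \<le> hausdorff2_outer (A \<union> B)" .
  qed
  finally show ?thesis .
qed

lemma closed_lambda_system_hausdorff2:
  fixes C :: "'a::metric_space set"
  assumes C: "closed C"
  shows "C \<in> lambda_system UNIV UNIV hausdorff2_outer"
proof -
  let ?h = "hausdorff2_outer :: 'a set \<Rightarrow> ennreal"
  have "?h (C \<inter> X) + ?h (X - C) \<le> ?h X" for X
  proof (cases "?h X = top \<or> C = {}")
    case True
    then show ?thesis by (auto simp: hausdorff2_outer_empty)
  next
    case False
    define A where "A n = {x\<in>X. infdist x C \<ge> 1 / real (Suc n)}" for n
    define R where "R n = {x\<in>X. 1 / real (Suc (Suc n)) \<le> infdist x C \<and> infdist x C < 1 / real (Suc n)}" for n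
    have sep: "?h Y + ?h Z \<le> ?h (Y \<union> Z)"
      if "Y \<subseteq> {x. infdist x C \<ge> b}" "Z \<subseteq> {x. infdist x C \<le> a}" "a < b" for Y Z a b
    proof (rule hausdorff2_outer_separated[of "b - a"])
      fix y z assume "y \<in> Y" "z \<in> Z"
      then show "b - a \<le> dist y z"
        using that infdist_triangle[of y C z] by fastforce
    qed (use that in auto)
    have XC: "X - C \<subseteq> A n \<union> (\<Union>k. R (k + n))" for n
    proof
      fix x assume x: "x \<in> X - C"
      then have pos: "infdist x C > 0"
        using C False by (metis DiffD2 in_closed_iff_infdist_zero infdist_nonneg less_eq_real_def)
      show "x \<in> A n \<union> (\<Union>k. R (k + n))"
      proof (cases "x \<in> A n")
        case nA: False
        define m where "m = (LEAST m. 1 / real (Suc m) \<le> infdist x C)"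
        obtain m0 where "1 / real (Suc m0) \<le> infdist x C"
          using nat_approx_posE[OF pos] less_imp_le by blast
        then have m: "1 / real (Suc m) \<le> infdist x C" unfolding m_def by (rule LeastI)
        have lt: "infdist x C < 1 / real (Suc k)" if "k < m" for k
          using not_less_Least[OF that[unfolded m_def]] by simp
        have "n < m"
        proof (rule ccontr)
          assume "\<not> n < m"
          then have "1 / real (Suc n) \<le> 1 / real (Suc m)" by (intro divide_left_mono) auto
          with m nA x show False by (auto simp: A_def)
        qed
        then obtain k where k: "m = Suc (k + n)"
          by (metis add.commute less_imp_Suc_add)
        then have "x \<in> R (k + n)" using m lt[of "k + n"] x by (auto simp: R_def)
        then show ?thesis by auto
      qed auto
    qed
    have RX: "(\<Union>k\<in>I. R k) \<subseteq> X" for I by (auto simp: R_def)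
    have sumR: "(\<Sum>k<n. ?h (R (2 * k + j))) \<le> ?h (\<Union>k<n. R (2 * k + j))" for n j
    proof (induction n)
      case (Suc n)
      have "(\<Sum>k<Suc n. ?h (R (2 * k + j))) \<le> ?h (\<Union>k<n. R (2 * k + j)) + ?h (R (2 * n + j))"
        using Suc by (simp add: add_right_mono)
      also have "\<dots> \<le> ?h ((\<Union>k<n. R (2 * k + j)) \<union> R (2 * n + j))"
      proof (cases "n = 0")
        case True then show ?thesis by (simp add: hausdorff2_outer_empty)
      next
        case False
        show ?thesis
        proof (rule sep[where a = "1 / real (Suc (2 * n + j))" and b = "1 / real (2 * n + j)"])
          show "(\<Union>k<n. R (2 * k + j)) \<subseteq> {x. 1 / real (2 * n + j) \<le> infdist x C}"
          proof clarsimp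
            fix k x assume "k < n" "x \<in> R (2 * k + j)"
            moreover have "1 / real (2 * n + j) \<le> 1 / real (Suc (Suc (2 * k + j)))"
              using \<open>k < n\<close> by (intro divide_left_mono) auto
            ultimately show "1 / (2 * real n + real j) \<le> infdist x C" by (auto simp: R_def)
          qed
          show "R (2 * n + j) \<subseteq> {x. infdist x C \<le> 1 / real (Suc (2 * n + j))}"
            by (auto simp: R_def)
          show "1 / real (Suc (2 * n + j)) < 1 / real (2 * n + j)"
            using False by (intro divide_strict_left_mono) auto
        qed
      qed
      also have "\<dots> = ?h (\<Union>k<Suc n. R (2 * k + j))" by (simp add: lessThan_Suc Un_commute)
      finally show ?case .
    qed (simp add: hausdorff2_outer_empty)
    have sum2: "(\<Sum>k. ?h (R (2 * k + j))) \<le> ?h X" for j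
    proof (rule suminf_le_const[OF summableI])
      fix n
      show "(\<Sum>k<n. ?h (R (2 * k + j))) \<le> ?h X"
        by (rule order_trans[OF sumR hausdorff2_outer_mono]) (auto simp: R_def)
    qed
    have "(\<Sum>k. ?h (R k)) \<le> ?h X + ?h X"
    proof (rule suminf_le_const[OF summableI])
      fix n
      have "(\<Sum>k<n. ?h (R k)) \<le> (\<Sum>k<2 * n. ?h (R k))" by (rule sum_mono2) auto
      also have "\<dots> = (\<Sum>k<n. ?h (R (2 * k + 0))) + (\<Sum>k<n. ?h (R (2 * k + 1)))"
        by (induction n) (auto simp: algebra_simps)
      also have "\<dots> \<le> ?h X + ?h X"
        by (intro add_mono order_trans[OF sum_le_suminf sum2]) (auto intro: summableI)
      finally show "(\<Sum>k<n. ?h (R k)) \<le> ?h X + ?h X" .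
    qed
    then have fin: "(\<Sum>k. ?h (R k)) < top"
      using False by (metis ennreal_add_less_top order_le_less_trans top.not_eq_extremum)
    have bound: "?h (C \<inter> X) + ?h (X - C) \<le> ?h X + (\<Sum>k. ?h (R (k + n)))" for n
    proof -
      have "?h (X - C) \<le> ?h (A n) + ?h (\<Union>k. R (k + n))"
        by (rule order_trans[OF hausdorff2_outer_mono[OF XC[of n]] hausdorff2_outer_Un])
      also have "\<dots> \<le> ?h (A n) + (\<Sum>k. ?h (R (k + n)))"
        by (intro add_left_mono hausdorff2_outer_UN)
      finally have "?h (C \<inter> X) + ?h (X - C) \<le> ?h (C \<inter> X) + (?h (A n) + (\<Sum>k. ?h (R (k + n))))"
        by (rule add_left_mono)
      also have "\<dots> = ?h (A n) + ?h (C \<inter> X) + (\<Sum>k. ?h (R (k + n)))"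
        by (simp add: ac_simps)
      also have "\<dots> \<le> ?h (A n \<union> (C \<inter> X)) + (\<Sum>k. ?h (R (k + n)))"
        by (intro add_right_mono sep[where a = 0 and b = "1 / real (Suc n)"]) (auto simp: A_def)
      also have "\<dots> \<le> ?h X + (\<Sum>k. ?h (R (k + n)))"
        by (intro add_right_mono hausdorff2_outer_mono) (auto simp: A_def)
      finally show ?thesis .
    qed
    have "(\<lambda>n. \<Sum>k. ?h (R (k + n))) \<longlonglongrightarrow> 0"
    proof -
      define g where "g k = enn2real (?h (R k))" for k
      have gk: "?h (R k) = ennreal (g k)" for k
        using ennreal_suminf_lessD[OF fin, of k] by (simp add: g_def)
      have g0: "0 \<le> g k" for k by (simp add: g_def)
      have sg: "summable g"
        using fin g0 unfolding gk by (intro summable_suminf_not_top) auto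
      have "(\<lambda>n. ennreal (\<Sum>k. g (k + n))) \<longlonglongrightarrow> ennreal 0"
        by (intro tendsto_ennrealI suminf_exist_split2 sg)
      moreover have "(\<Sum>k. ?h (R (k + n))) = ennreal (\<Sum>k. g (k + n))" for n
        unfolding gk by (rule suminf_ennreal2) (auto simp: g0 sg summable_iff_shift)
      ultimately show ?thesis by simp
    qed
    then have "(\<lambda>n. ?h X + (\<Sum>k. ?h (R (k + n)))) \<longlonglongrightarrow> ?h X + 0"
      by (intro tendsto_add tendsto_const)
    then show ?thesis
      by (intro LIMSEQ_le_const[of _ "?h X"]) (use bound in auto)
  qed
  moreover have "?h X \<le> ?h (C \<inter> X) + ?h (X - C)" for X
    using hausdorff2_outer_Un[of "C \<inter> X" "X - C"] by (metis Int_commute Un_Diff_Int Un_commute)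
  ultimately show ?thesis
    by (auto simp: lambda_system_def Diff_eq Int_commute intro: antisym)
qed

lemma measure_space_hausdorff2: "measure_space UNIV (sets borel) hausdorff2_outer"
proof -
  interpret sigma_algebra UNIV "UNIV :: 'a set set" by (metis Pow_UNIV sigma_algebra_Pow)
  let ?L = "lambda_system UNIV UNIV (hausdorff2_outer :: 'a set \<Rightarrow> ennreal)"
  have ms: "measure_space UNIV ?L hausdorff2_outer"
    by (rule caratheodory_lemma[OF outer_measure_space_hausdorff2])
  then have "sigma_algebra UNIV ?L" by (simp add: measure_space_def)
  then have "sigma_sets UNIV (Collect closed) \<subseteq> ?L"
    by (rule sigma_algebra.sigma_sets_subset) (auto intro: closed_lambda_system_hausdorff2)
  then have "sets borel \<subseteq> ?L" by (simp add: borel_eq_closed)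
  then show ?thesis
    using measure_down[OF ms] by (metis sets.sigma_algebra_axioms space_borel)
qed

lemma sets_hausdorff2 [simp, measurable_cong]: "sets hausdorff2 = sets borel"
  and space_hausdorff2 [simp]: "space hausdorff2 = UNIV"
  using sets.sigma_sets_eq[of "borel :: 'a measure"]
  by (auto simp: hausdorff2_def sets_measure_of space_measure_of)

lemma emeasure_hausdorff2: "A \<in> sets borel \<Longrightarrow> emeasure hausdorff2 A = hausdorff2_outer A"
  unfolding hausdorff2_def
  by (rule emeasure_measure_of_sigma)
    (use measure_space_hausdorff2 in \<open>auto simp: measure_space_def\<close>)


definition L2 :: "'a measure \<Rightarrow> 'a set \<Rightarrow> ('a \<Rightarrow> 'b::real_normed_vector) \<Rightarrow> real" where
  "L2 M A f = sqrt (LINT x:A|M. (norm (f x))\<^sup>2)"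

definition Linf :: "'a measure \<Rightarrow> 'a set \<Rightarrow> ('a \<Rightarrow> 'b::real_normed_vector) \<Rightarrow> ennreal" where
  "Linf M A f = esssup (restrict_space M A) (\<lambda>x. ennreal (norm (f x)))"

text \<open>On an open set, \<open>C^k\<close> regularity is expressed through iterated partial derivatives.\<close>

fun Ck_on :: "nat \<Rightarrow> 'a::euclidean_space set \<Rightarrow> ('a \<Rightarrow> 'b::real_normed_vector) \<Rightarrow> bool" where
  "Ck_on 0 U f \<longleftrightarrow> continuous_on U f"
| "Ck_on (Suc k) U f \<longleftrightarrow>
     f differentiable_on U \<and> (\<forall>b\<in>Basis. Ck_on k U (\<lambda>x. frechet_derivative f (at x) b))"

definition smooth_on :: "'a::euclidean_space set \<Rightarrow> ('a \<Rightarrow> 'b::real_normed_vector) \<Rightarrow> bool" where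
  "smooth_on U f \<longleftrightarrow> open U \<and> (\<forall>k. Ck_on k U f)"

text \<open>The gradient is taken relative to a set \<open>S\<close>.  For a closed tetrahedron \<open>S\<close> this is, also at
  boundary points, the gradient of the restriction of the function to \<open>S\<close>.\<close>

definition grad_within :: "point set \<Rightarrow> (point \<Rightarrow> real) \<Rightarrow> point \<Rightarrow> point" where
  "grad_within S f x = (\<chi> i. frechet_derivative f (at x within S) (axis i 1))"

abbreviation grad :: "(point \<Rightarrow> real) \<Rightarrow> point \<Rightarrow> point" where
  "grad \<equiv> grad_within UNIV"

definition smooth_surface :: "point set \<Rightarrow> bool" where
  "smooth_surface M \<longleftrightarrow>
     (\<forall>x\<in>M. \<exists>U f. x \<in> U \<and> smooth_on U f \<and> (\<forall>y\<in>U. grad f y \<noteq> 0) \<and> M \<inter> U = {y\<in>U. f y = 0})"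

definition signed_distance :: "point set \<Rightarrow> point \<Rightarrow> real" where
  "signed_distance M x = (if x \<in> inside M then - infdist x M else infdist x M)"

definition Pk :: "nat \<Rightarrow> (point \<Rightarrow> real) set" where
  "Pk m = {p. \<exists>a. \<forall>x. p x =
     (\<Sum>i\<le>m. \<Sum>j\<le>m - i. \<Sum>k\<le>m - i - j. a i j k * (x$1)^i * (x$2)^j * (x$3)^k)}"


text \<open>The continuous problem.  \<open>nbhd\<close> is the space-time neighbourhood of the surface whose time
  sections carry the signed distance function and the closest point projection.\<close>

record evolving_surface =
  dom :: "point set"
  Tend :: real
  vel :: "point \<Rightarrow> real \<Rightarrow> point"
  visc :: real
  surf :: "real \<Rightarrow> point set"
  lvl :: "point \<Rightarrow> real \<Rightarrow> real"
  nbhd :: "(point \<times> real) set"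

definition nbhd_at :: "evolving_surface \<Rightarrow> real \<Rightarrow> point set" where
  "nbhd_at P t = {x. (x, t) \<in> nbhd P}"

text \<open>The unit normal, oriented by the level set function; on the surface and in its
  neighbourhood the gradient of the level set function has length one.\<close>

definition nrm :: "evolving_surface \<Rightarrow> point \<Rightarrow> real \<Rightarrow> point" where
  "nrm P x t = (let g = grad (\<lambda>y. lvl P y t) x in g /\<^sub>R norm g)"

definition wN :: "evolving_surface \<Rightarrow> point \<Rightarrow> real \<Rightarrow> real" where
  "wN P x t = vel P x t \<bullet> nrm P x t"

definition wT :: "evolving_surface \<Rightarrow> point \<Rightarrow> real \<Rightarrow> point" where
  "wT P x t = vel P x t - wN P x t *\<^sub>R nrm P x t"

text \<open>The last conjunct says that the normal velocity of the surface is \<open>wN\<close>: the normal speed of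
  a moving level set is minus the time derivative of the level set function divided by the length
  of its gradient.\<close>

definition is_evolving_surface :: "evolving_surface \<Rightarrow> bool" where
  "is_evolving_surface P \<longleftrightarrow>
     open (dom P) \<and> connected (dom P) \<and> dom P \<noteq> {} \<and> Tend P > 0 \<and> visc P > 0 \<and>
     (\<exists>W. closure (dom P) \<times> {0..Tend P} \<subseteq> W \<and>
        smooth_on W (\<lambda>(x, t). vel P x t) \<and> smooth_on W (\<lambda>(x, t). lvl P x t)) \<and>
     open (nbhd P) \<and>
     (\<forall>t\<in>{0..Tend P}.
        compact (surf P t) \<and> connected (surf P t) \<and> surf P t \<noteq> {} \<and> smooth_surface (surf P t) \<and>
        surf P t \<subseteq> nbhd_at P t \<and> nbhd_at P t \<subseteq> dom P \<and>
        surf P t = {x\<in>dom P. lvl P x t = 0} \<and>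
        (\<forall>x\<in>nbhd_at P t. lvl P x t = signed_distance (surf P t) x) \<and>
        (\<forall>x\<in>surf P t. - deriv (\<lambda>s. lvl P x s) t / norm (grad (\<lambda>y. lvl P y t) x) = wN P x t))"


text \<open>Discretization data: mesh size, mesh (closed tetrahedra), discrete level set function,
  number of time steps.\<close>

record discretization =
  hsize :: real
  mesh :: "point set set"
  lvlh :: "point \<Rightarrow> real \<Rightarrow> real"
  nsteps :: nat

text \<open>A quasi-uniform, shape regular family is a collection of pairs of mesh size and mesh that
  satisfy this predicate with common positive constants \<open>\<sigma>\<close> and \<open>\<kappa>\<close>.\<close>

definition admissible_mesh :: "point set \<Rightarrow> real \<Rightarrow> real \<Rightarrow> real \<Rightarrow> point set set \<Rightarrow> bool" where
  "admissible_mesh Om \<sigma> \<kappa> h Th \<longleftrightarrow>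
     h > 0 \<and> triangulation Th \<and> \<Union>Th = closure Om \<and>
     (\<forall>S\<in>Th. 3 simplex S \<and> diameter S \<le> h \<and> \<kappa> * h \<le> diameter S \<and>
        (\<exists>x. ball x (\<sigma> * diameter S) \<subseteq> S))"

definition dt :: "evolving_surface \<Rightarrow> discretization \<Rightarrow> real" where
  "dt P D = Tend P / real (nsteps D)"

definition tn :: "evolving_surface \<Rightarrow> discretization \<Rightarrow> nat \<Rightarrow> real" where
  "tn P D n = real n * dt P D"

definition Linf_I ::
  "evolving_surface \<Rightarrow> discretization \<Rightarrow> nat \<Rightarrow> (point \<Rightarrow> real \<Rightarrow> 'b::real_normed_vector) \<Rightarrow> ennreal" where
  "Linf_I P D n g =
     (if n = 0 then Linf hausdorff2 (surf P 0) (\<lambda>x. g x 0)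
      else (SUP t\<in>{tn P D (n - 1)..<tn P D n}. Linf hausdorff2 (surf P t) (\<lambda>x. g x t)))"

text \<open>Both norms are finite, since \<open>wN\<close> is smooth and the surfaces sweep out a compact set.\<close>

definition wN_I :: "evolving_surface \<Rightarrow> discretization \<Rightarrow> nat \<Rightarrow> real" where
  "wN_I P D n = enn2real (Linf_I P D n (wN P))"

definition grad_wN_I :: "evolving_surface \<Rightarrow> discretization \<Rightarrow> nat \<Rightarrow> real" where
  "grad_wN_I P D n = enn2real (Linf_I P D n (\<lambda>x t. grad (\<lambda>y. wN P y t) x))"

text \<open>Piecewise gradients: at a point shared by several tetrahedra one of them is selected; the
  selection depends only on the set of tetrahedra containing the point.  The union of the faces is
  Lebesgue null.  Surface measure may charge a face contained in the discrete surface, but there the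
  tangential gradient of a continuous piecewise polynomial is the same from both sides.\<close>

definition elem :: "point set set \<Rightarrow> point \<Rightarrow> point set" where
  "elem Th x = (SOME S. S \<in> Th \<and> x \<in> S)"

definition bgrad :: "discretization \<Rightarrow> (point \<Rightarrow> real) \<Rightarrow> point \<Rightarrow> point" where
  "bgrad D f x = grad_within (elem (mesh D) x) f x"

definition lvlhn :: "evolving_surface \<Rightarrow> discretization \<Rightarrow> nat \<Rightarrow> point \<Rightarrow> real" where
  "lvlhn P D n x = lvlh D x (tn P D n)"

definition Gh :: "evolving_surface \<Rightarrow> discretization \<Rightarrow> nat \<Rightarrow> point set" where
  "Gh P D n = {x\<in>dom P. lvlhn P D n x = 0}"

definition nh :: "evolving_surface \<Rightarrow> discretization \<Rightarrow> nat \<Rightarrow> point \<Rightarrow> point" where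
  "nh P D n x = (let g = bgrad D (lvlhn P D n) x in g /\<^sub>R norm g)"

definition delta :: "evolving_surface \<Rightarrow> discretization \<Rightarrow> real \<Rightarrow> nat \<Rightarrow> real" where
  "delta P D c\<delta> n = c\<delta> * wN_I P D n * dt P D"

definition Udelta :: "evolving_surface \<Rightarrow> discretization \<Rightarrow> real \<Rightarrow> nat \<Rightarrow> point set" where
  "Udelta P D c\<delta> n = {x\<in>dom P. \<bar>lvlhn P D n x\<bar> < delta P D c\<delta> n}"

definition Sh :: "evolving_surface \<Rightarrow> discretization \<Rightarrow> real \<Rightarrow> nat \<Rightarrow> point set set" where
  "Sh P D c\<delta> n = {S\<in>mesh D. \<exists>x\<in>S. \<bar>lvlhn P D n x\<bar> \<le> delta P D c\<delta> n}"

definition Oh :: "evolving_surface \<Rightarrow> discretization \<Rightarrow> real \<Rightarrow> nat \<Rightarrow> point set" where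
  "Oh P D c\<delta> n = interior (\<Union>(Sh P D c\<delta> n))"

definition OGh :: "evolving_surface \<Rightarrow> discretization \<Rightarrow> nat \<Rightarrow> point set" where
  "OGh P D n = interior (\<Union>{S\<in>mesh D. emeasure hausdorff2 (S \<inter> Gh P D n) > 0})"

text \<open>Elements of the finite element space are functions on \<open>Oh\<close>, so no condition is imposed at
  boundary points of tetrahedra that lie outside this open set.\<close>

definition Vh :: "evolving_surface \<Rightarrow> discretization \<Rightarrow> real \<Rightarrow> nat \<Rightarrow> nat \<Rightarrow> (point \<Rightarrow> real) set" where
  "Vh P D c\<delta> m n = {v. continuous_on (Oh P D c\<delta> n) v \<and>
     (\<forall>S\<in>Sh P D c\<delta> n. \<exists>p\<in>Pk m. \<forall>x\<in>S \<inter> Oh P D c\<delta> n. v x = p x)}"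

text \<open>The constants \<open>C1\<close>, \<open>C2\<close>, \<open>C3\<close> are the hidden ones in the approximation estimates.  The
  gradient of \<open>lvlh\<close> is required not to vanish on the closed tetrahedra of the narrow band, from
  within each of them.\<close>

definition is_discretization ::
  "evolving_surface \<Rightarrow> real \<Rightarrow> real \<Rightarrow> real \<Rightarrow> real \<Rightarrow> real \<Rightarrow> nat \<Rightarrow> real \<Rightarrow> discretization \<Rightarrow> bool" where
  "is_discretization P \<sigma> \<kappa> C1 C2 C3 q c\<delta> D \<longleftrightarrow>
     admissible_mesh (dom P) \<sigma> \<kappa> (hsize D) (mesh D) \<and> nsteps D \<ge> 1 \<and>
     (\<forall>t\<in>{0..Tend P}.
        continuous_on (closure (dom P)) (\<lambda>x. lvlh D x t) \<and>
        (\<forall>S\<in>mesh D. \<exists>k. \<exists>p\<in>Pk k. \<forall>x\<in>S. lvlh D x t = p x) \<and>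
        Linf lborel (dom P) (\<lambda>x. lvl P x t - lvlh D x t)
          + ennreal (hsize D) * Linf lborel (dom P) (bgrad D (\<lambda>x. lvl P x t - lvlh D x t))
          \<le> ennreal (C1 * hsize D ^ (q + 1))) \<and>
     (\<forall>n\<in>{1..nsteps D}.
        Linf lborel (dom P) (\<lambda>x. lvlhn P D (n - 1) x - lvlhn P D n x)
          \<le> ennreal (C2 * (dt P D * wN_I P D n)) \<and>
        Linf lborel (dom P) (\<lambda>x. bgrad D (lvlhn P D (n - 1)) x - bgrad D (lvlhn P D n) x)
          \<le> ennreal (C3 * (dt P D * (wN_I P D n + grad_wN_I P D n)))) \<and>
     (\<forall>n\<le>nsteps D. \<forall>S\<in>Sh P D c\<delta> n. \<forall>x\<in>S. grad_within S (lvlhn P D n) x \<noteq> 0) \<and>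
     (\<forall>n\<le>nsteps D. Oh P D c\<delta> n \<subseteq> nbhd_at P (tn P D n)) \<and>
     (\<forall>n<nsteps D. OGh P D (n + 1) \<subseteq> nbhd_at P (tn P D n))"


definition ngrad :: "evolving_surface \<Rightarrow> discretization \<Rightarrow> nat \<Rightarrow> (point \<Rightarrow> real) \<Rightarrow> point \<Rightarrow> real" where
  "ngrad P D n u x = nh P D n x \<bullet> bgrad D u x"

definition tgrad :: "evolving_surface \<Rightarrow> discretization \<Rightarrow> nat \<Rightarrow> (point \<Rightarrow> real) \<Rightarrow> point \<Rightarrow> point" where
  "tgrad P D n u x = bgrad D u x - ngrad P D n u x *\<^sub>R nh P D n x"

definition tdiv :: "evolving_surface \<Rightarrow> discretization \<Rightarrow> nat \<Rightarrow> (point \<Rightarrow> point) \<Rightarrow> point \<Rightarrow> real" where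
  "tdiv P D n f x = (\<Sum>i\<in>UNIV. tgrad P D n (\<lambda>y. f y $ i) x $ i)"

definition pn :: "evolving_surface \<Rightarrow> discretization \<Rightarrow> nat \<Rightarrow> point \<Rightarrow> point" where
  "pn P D n x = closest_point (surf P (tn P D n)) x"

definition we :: "evolving_surface \<Rightarrow> discretization \<Rightarrow> nat \<Rightarrow> point \<Rightarrow> point" where
  "we P D n x = vel P (pn P D n x) (tn P D n)"

definition wTe :: "evolving_surface \<Rightarrow> discretization \<Rightarrow> nat \<Rightarrow> point \<Rightarrow> point" where
  "wTe P D n x = wT P (pn P D n x) (tn P D n)"

definition divw :: "evolving_surface \<Rightarrow> discretization \<Rightarrow> nat \<Rightarrow> point \<Rightarrow> real" where
  "divw P D n = tdiv P D n (\<lambda>y. we P D n y - (1/2) *\<^sub>R wTe P D n y)"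

definition a_form ::
  "evolving_surface \<Rightarrow> discretization \<Rightarrow> real \<Rightarrow> (nat \<Rightarrow> real) \<Rightarrow> nat \<Rightarrow>
     (point \<Rightarrow> real) \<Rightarrow> (point \<Rightarrow> real) \<Rightarrow> real" where
  "a_form P D c\<delta> \<rho> n u v =
     (LINT x:Gh P D n|hausdorff2.
        1/2 * (wTe P D n x \<bullet> tgrad P D n u x) * v x
        - 1/2 * (wTe P D n x \<bullet> tgrad P D n v x) * u x
        + divw P D n x * u x * v x)
     + visc P * (LINT x:Gh P D n|hausdorff2. tgrad P D n u x \<bullet> tgrad P D n v x)
     + \<rho> n * (LINT x:Oh P D c\<delta> n|lborel. ngrad P D n u x * ngrad P D n v x)"

definition FD_solution ::
  "evolving_surface \<Rightarrow> discretization \<Rightarrow> real \<Rightarrow> nat \<Rightarrow> (nat \<Rightarrow> real) \<Rightarrow> (nat \<Rightarrow> point \<Rightarrow> real) \<Rightarrow> bool" where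
  "FD_solution P D c\<delta> m \<rho> u \<longleftrightarrow>
     (\<forall>n\<le>nsteps D. u n \<in> Vh P D c\<delta> m n) \<and>
     (\<forall>n\<in>{1..nsteps D}. \<forall>v\<in>Vh P D c\<delta> m n.
        (LINT x:Gh P D n|hausdorff2. (u n x - u (n - 1) x) / dt P D * v x)
        + a_form P D c\<delta> \<rho> n (u n) v = 0)"


text \<open>Conditions C1 and C3 are multiplied out: with the convention \<open>1 / 0 = \<infinity>\<close> they are void when the
  velocity bound, respectively \<open>\<xi>\<^sub>h\<close>, is zero, whereas \<open>1 / 0 = 0\<close> here.\<close>

definition cond_C1 :: "evolving_surface \<Rightarrow> discretization \<Rightarrow> real \<Rightarrow> real \<Rightarrow> bool" where
  "cond_C1 P D c\<delta> cl \<longleftrightarrow> (\<forall>n\<in>{1..nsteps D}. dt P D * (c\<delta> * wN_I P D n) \<le> cl)"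

definition cond_N2 :: "evolving_surface \<Rightarrow> discretization \<Rightarrow> real \<Rightarrow> bool" where
  "cond_N2 P D c\<delta> \<longleftrightarrow> (\<forall>n\<in>{1..nsteps D}.
     Gh P D n \<subseteq> Udelta P D c\<delta> (n - 1) \<and> OGh P D n \<subseteq> Oh P D c\<delta> (n - 1))"

definition cond_C2 :: "evolving_surface \<Rightarrow> discretization \<Rightarrow> nat \<Rightarrow> real \<Rightarrow> bool" where
  "cond_C2 P D q ch \<longleftrightarrow> hsize D ^ (2 * q) \<le> ch * dt P D"

definition xi_h :: "evolving_surface \<Rightarrow> discretization \<Rightarrow> ennreal" where
  "xi_h P D = Max ((\<lambda>n. Linf hausdorff2 (Gh P D n) (divw P D n)) ` {0..nsteps D})"

definition cond_C3 :: "evolving_surface \<Rightarrow> discretization \<Rightarrow> bool" where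
  "cond_C3 P D \<longleftrightarrow> ennreal (dt P D) * (4 * xi_h P D) \<le> 1"

definition trace_estimate ::
  "evolving_surface \<Rightarrow> discretization \<Rightarrow> real \<Rightarrow> nat \<Rightarrow> real \<Rightarrow> real \<Rightarrow> bool" where
  "trace_estimate P D c\<delta> m ca cb \<longleftrightarrow>
     (\<forall>n\<in>{1..nsteps D}. \<forall>v\<in>Vh P D c\<delta> m (n - 1).
        (L2 hausdorff2 (Gh P D n) v)\<^sup>2
        \<le> (1 + ca * dt P D) * (L2 hausdorff2 (Gh P D (n - 1)) v)\<^sup>2
          + cb * delta P D c\<delta> (n - 1) / (delta P D c\<delta> (n - 1) + hsize D)
            * (L2 lborel (Oh P D c\<delta> (n - 1)) (ngrad P D (n - 1) v))\<^sup>2)"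

definition cond_C4 ::
  "evolving_surface \<Rightarrow> discretization \<Rightarrow> real \<Rightarrow> nat \<Rightarrow> real \<Rightarrow> real \<Rightarrow> (nat \<Rightarrow> real) \<Rightarrow> bool" where
  "cond_C4 P D c\<delta> m ca cb \<rho> \<longleftrightarrow>
     trace_estimate P D c\<delta> m ca cb \<and>
     (\<forall>n\<in>{1..nsteps D}. \<rho> n \<ge> c\<delta> * cb * wN_I P D n / (delta P D c\<delta> n + hsize D))"

definition rho0 :: "evolving_surface \<Rightarrow> discretization \<Rightarrow> real \<Rightarrow> real \<Rightarrow> real" where
  "rho0 P D c\<delta> cb = cb * delta P D c\<delta> 0 / (delta P D c\<delta> 0 + hsize D)"

end

theory Submission
  imports Defs
begin

text \<open>Testing with \<open>u\<^sub>h\<^sup>n\<close> makes the transport part of the bilinear form vanish, and the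
  remaining zeroth-order term is controlled by the surface divergence.  On the neighbourhood of the
  surface the closest point projection is \<open>x - \<phi>(x) \<nabla>\<phi>(x)\<close> with the smooth level set function
  \<open>\<phi>\<close>, so this divergence is bounded by a constant that depends on the continuous problem only.
  The trace estimate moves \<open>u\<^sub>h\<^sup>n\<^sup>-\<^sup>1\<close> from one discrete surface to the next at the price of a
  normal derivative, which the stabilisation of the previous step absorbs by (C4), and a discrete
  Gronwall argument concludes.  That the integrals involved are genuine rests on the discrete surfaces
  having finite area: the zero set of a polynomial with nonvanishing gradient is locally a
  Lipschitz graph over a coordinate plane.\<close>

subsection \<open>Finiteness of two-dimensional Hausdorff measure\<close>

text \<open>Two demands shape the proof: the prefactor 3/2, and the choice of \<open>c\<close> and
  \<open>\<tau>\<close> before the discretization is known. The weight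
  \<open>1 - 2 * C * dt P D\<close> in front of the new surface norm costs at most 3/2 once
  \<open>2 * C * dt P D \<le> 1/3\<close>, so \<open>C\<close> has to bound the surface divergence
  on all discrete surfaces at once. Compactness of the space-time cylinder over
  \<open>closure (dom P)\<close> provides it. A third constraint comes from the Bochner integral,
  which is 0 for non-integrable functions: linearity and monotonicity may be used only where
  integrability is known. Finite element functions are bounded and continuous on the discrete
  surfaces, so finite area suffices for them. Piecewise gradients depend on a chosen tetrahedron;
  their square integrals are carried along as unanalysed terms, and the divergence term is only
  dominated pointwise.\<close>

lemma hausdorff2_pre_le_card:
  fixes Z :: "'a::real_normed_vector set" and key :: "'a \<Rightarrow> nat"
  assumes key: "\<And>x. x \<in> Z \<Longrightarrow> key x < k"
    and close: "\<And>x y. x \<in> Z \<Longrightarrow> y \<in> Z \<Longrightarrow> key x = key y \<Longrightarrow> dist x y \<le> e"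
    and e: "0 \<le> e" "e \<le> d"
  shows "hausdorff2_pre d Z \<le> ennreal (real k * (pi / 4 * e\<^sup>2))"
proof -
  define U where "U i = {x\<in>Z. key x = i}" for i
  have diam: "diameter (U i) \<le> e" for i
    by (rule diameter_le) (use e close in \<open>auto simp: U_def dist_norm\<close>)
  have bdd: "bounded (U i)" for i
  proof (cases "U i = {}")
    case False
    then obtain a where "a \<in> U i" by auto
    then show ?thesis
      unfolding bounded_def using close by (intro exI[of _ a] exI[of _ e]) (auto simp: U_def)
  qed simp
  have "hausdorff2_pre d Z \<le> (\<Sum>i. ennreal (pi / 4 * diameter (U i) ^ 2))"
  proof (rule hausdorff2_pre_le)
    show "Z \<subseteq> (\<Union>i. U i)" by (auto simp: U_def)
    show "diameter (U i) \<le> d" for i using diam[of i] e by linarith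
  qed (rule bdd)
  also have "\<dots> = (\<Sum>i<k. ennreal (pi / 4 * diameter (U i) ^ 2))"
  proof (rule suminf_finite)
    fix n assume "n \<notin> {..<k}"
    then have "U n = {}" using key by (auto simp: U_def)
    then show "ennreal (pi / 4 * diameter (U n) ^ 2) = 0" by simp
  qed simp
  also have "\<dots> \<le> (\<Sum>i<k. ennreal (pi / 4 * e\<^sup>2))"
    by (intro sum_mono ennreal_leI mult_left_mono power_mono diam diameter_ge_0 bdd) auto
  also have "\<dots> = ennreal (real k * (pi / 4 * e\<^sup>2))"
    by (simp add: ennreal_mult[symmetric] ennreal_of_nat_eq_real_of_nat)
  finally show ?thesis .
qed

text \<open>The pair \<open>(a, b)\<close> maps \<open>Z\<close> into a square of side
  \<open>2 * R\<close> with Lipschitz inverse. Cutting the square into cells, the number of pieces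
  grows like \<open>N\<^sup>2\<close> while the squared diameters shrink like
  \<open>1 / N\<^sup>2\<close>, so the bound does not depend on \<open>d\<close>.\<close>

lemma hausdorff2_outer_chart_finite:
  fixes Z :: "'a::real_normed_vector set" and a b :: "'a \<Rightarrow> real"
  assumes L: "\<And>x y. x \<in> Z \<Longrightarrow> y \<in> Z \<Longrightarrow> dist x y \<le> L * (\<bar>a x - a y\<bar> + \<bar>b x - b y\<bar>)"
    and R: "\<And>x. x \<in> Z \<Longrightarrow> \<bar>a x\<bar> \<le> R" "\<And>x. x \<in> Z \<Longrightarrow> \<bar>b x\<bar> \<le> R"
    and pos: "L > 0" "R > 0"
  shows "hausdorff2_outer Z < top"
proof -
  have "hausdorff2_pre d Z \<le> ennreal (16 * pi * (L * R)\<^sup>2)" if d: "d \<in> {0<..}" for d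
  proof -
    \<comment> \<open>This makes the diameter bound
      \<open>2 * L * \<epsilon> = 4 * L * R / N\<close> of a piece at most \<open>d\<close>.\<close>
    obtain N :: nat where N: "N > 4 * L * R / d" using reals_Archimedean2 by blast
    have N0: "N > 0"
    proof (rule ccontr)
      assume "\<not> N > 0"
      then have "4 * L * R / d < 0" using N by simp
      moreover have "4 * L * R / d > 0" using pos d by simp
      ultimately show False by linarith
    qed
    define \<epsilon> where "\<epsilon> = 2 * R / N"
    have \<epsilon>: "\<epsilon> > 0" using pos N0 by (simp add: \<epsilon>_def)
    define cell where "cell s = nat \<lfloor>(s + R) / \<epsilon>\<rfloor>" for s
    have cell_le: "cell s \<le> N" if "\<bar>s\<bar> \<le> R" for s
    proof -
      have "(s + R) / \<epsilon> \<le> 2 * R / \<epsilon>" using that \<epsilon> by (intro divide_right_mono) auto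
      also have "\<dots> = real N" using pos N0 by (simp add: \<epsilon>_def)
      finally show ?thesis unfolding cell_def by linarith
    qed
    have cell_eq: "\<bar>s - t\<bar> \<le> \<epsilon>" if "cell s = cell t" "\<bar>s\<bar> \<le> R" "\<bar>t\<bar> \<le> R" for s t
    proof -
      have "(s + R) / \<epsilon> \<ge> 0" "(t + R) / \<epsilon> \<ge> 0" using that \<epsilon> by auto
      then have "\<bar>(s + R) / \<epsilon> - (t + R) / \<epsilon>\<bar> \<le> 1"
        using that(1) unfolding cell_def by linarith
      also have "(s + R) / \<epsilon> - (t + R) / \<epsilon> = (s - t) / \<epsilon>"
        by (simp add: diff_divide_distrib add_divide_distrib)
      finally show ?thesis using \<epsilon> by (simp add: abs_divide divide_le_eq)
    qed
    \<comment> \<open>The pair of cell numbers written in base \<open>N + 1\<close>. There are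
      \<open>N + 1\<close> cells per direction, not \<open>N\<close>, since the right end point
      \<open>R\<close> falls into cell \<open>N\<close>.\<close>
    define key where "key x = cell (a x) * (N + 1) + cell (b x)" for x
    have "hausdorff2_pre d Z \<le> ennreal (real ((N + 1) * (N + 1)) * (pi / 4 * (2 * L * \<epsilon>)\<^sup>2))"
    proof (rule hausdorff2_pre_le_card[where key = key])
      fix x assume x: "x \<in> Z"
      have "cell (a x) * (N + 1) \<le> N * (N + 1)" by (intro mult_right_mono cell_le R x) auto
      then show "key x < (N + 1) * (N + 1)"
        using cell_le[OF R(2)[OF x]] by (simp add: key_def)
    next
      fix x y assume xy: "x \<in> Z" "y \<in> Z" "key x = key y"
      have c: "cell (a x) = key x div (N + 1) \<and> cell (b x) = key x mod (N + 1)" if "x \<in> Z" for x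
      proof -
        have "cell (b x) < N + 1" using cell_le[OF R(2)[OF that]] by simp
        then show ?thesis
          unfolding key_def by (simp add: div_mult_self3 mod_mult_self3 del: add_Suc_right)
      qed
      have "dist x y \<le> L * (\<bar>a x - a y\<bar> + \<bar>b x - b y\<bar>)" using L xy by blast
      also have "\<dots> \<le> L * (\<epsilon> + \<epsilon>)"
        using xy c[of x] c[of y] pos R by (intro mult_left_mono add_mono cell_eq) auto
      finally show "dist x y \<le> 2 * L * \<epsilon>" by simp
    next
      have "4 * L * R < d * N" using N d by (simp add: field_simps)
      then have "4 * L * R / N \<le> d" using N0 by (simp add: field_simps)
      then show "2 * L * \<epsilon> \<le> d" by (simp add: \<epsilon>_def)
      show "0 \<le> 2 * L * \<epsilon>" using pos \<epsilon> by simp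
    qed
    also have "\<dots> \<le> ennreal (16 * pi * (L * R)\<^sup>2)"
    proof (rule ennreal_leI)
      have "real ((N + 1) * (N + 1)) \<le> (2 * N) * (2 * N)" unfolding of_nat_mult
        using N0 by (intro mult_mono) auto
      then have "real ((N + 1) * (N + 1)) * (pi / 4 * (2 * L * \<epsilon>)\<^sup>2)
          \<le> (2 * N) * (2 * N) * (pi / 4 * (2 * L * \<epsilon>)\<^sup>2)"
        by (intro mult_right_mono) auto
      also have "\<dots> = 16 * pi * (L * R)\<^sup>2"
        using N0 by (simp add: \<epsilon>_def power2_eq_square field_simps)
      finally show "real ((N + 1) * (N + 1)) * (pi / 4 * (2 * L * \<epsilon>)\<^sup>2) \<le> 16 * pi * (L * R)\<^sup>2" .
    qed
    finally show ?thesis .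
  qed
  then have "hausdorff2_outer Z \<le> ennreal (16 * pi * (L * R)\<^sup>2)"
    unfolding hausdorff2_outer_def by (rule SUP_least)
  then show ?thesis by (rule order.strict_trans1) simp
qed

lemma hausdorff2_outer_finite_Union:
  assumes "finite I" "\<And>i. i \<in> I \<Longrightarrow> hausdorff2_outer (A i) < top"
  shows "hausdorff2_outer (\<Union>i\<in>I. A i) < top"
  using assms
proof (induction I rule: finite_induct)
  case (insert i I)
  have "hausdorff2_outer (\<Union>i\<in>insert i I. A i) \<le> hausdorff2_outer (A i) + hausdorff2_outer (\<Union>i\<in>I. A i)"
    using hausdorff2_outer_Un by simp
  also have "\<dots> < top" using insert by simp
  finally show ?case .
qed (simp add: hausdorff2_outer_empty)

subsection \<open>Zero sets of functions with nonvanishing gradient\<close>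

text \<open>The gradient is carried as a witness on the whole space. Polynomials extend beyond their
  tetrahedron, so faces need no special treatment here.\<close>

definition C1_grad :: "(point \<Rightarrow> real) \<Rightarrow> (point \<Rightarrow> point) \<Rightarrow> bool" where
  "C1_grad p p' \<longleftrightarrow> continuous_on UNIV p' \<and> (\<forall>x. (p has_derivative (\<lambda>v. p' x \<bullet> v)) (at x))"

lemma C1_grad_const: "C1_grad (\<lambda>x. c) (\<lambda>x. 0)"
  by (simp add: C1_grad_def)

lemma C1_grad_coord: "C1_grad (\<lambda>x. x $ i) (\<lambda>x. axis i 1)"
  by (auto simp: C1_grad_def inner_axis' intro!: bounded_linear_imp_has_derivative)

lemma C1_grad_continuous: "C1_grad p p' \<Longrightarrow> continuous_on UNIV p"
  unfolding C1_grad_def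
  by (meson continuous_at_imp_continuous_on has_derivative_continuous)

lemma C1_grad_mult:
  assumes "C1_grad p p'" "C1_grad r r'"
  shows "C1_grad (\<lambda>x. p x * r x) (\<lambda>x. p x *\<^sub>R r' x + r x *\<^sub>R p' x)"
  using assms C1_grad_continuous[OF assms(1)] C1_grad_continuous[OF assms(2)]
  unfolding C1_grad_def
  by (auto intro!: continuous_intros derivative_eq_intros simp: inner_simps algebra_simps)

lemma C1_grad_sum:
  assumes "\<And>i. i \<in> I \<Longrightarrow> \<exists>p'. C1_grad (p i) p'"
  shows "\<exists>p'. C1_grad (\<lambda>x. \<Sum>i\<in>I. p i x) p'"
proof -
  obtain p' where "\<forall>i\<in>I. C1_grad (p i) (p' i)"
    using bchoice[of I "\<lambda>i. C1_grad (p i)"] assms by blast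
  then have "C1_grad (\<lambda>x. \<Sum>i\<in>I. p i x) (\<lambda>x. \<Sum>i\<in>I. p' i x)"
    unfolding C1_grad_def
    by (auto intro!: continuous_intros derivative_eq_intros simp: inner_sum_left)
  then show ?thesis by blast
qed

lemma C1_grad_power:
  assumes "C1_grad p p'"
  shows "\<exists>r'. C1_grad (\<lambda>x. p x ^ k) r'"
proof (induction k)
  case (Suc k)
  then show ?case using C1_grad_mult[OF assms] by auto
qed (use C1_grad_const in auto)

lemma Pk_C1_grad:
  assumes "p \<in> Pk m"
  shows "\<exists>p'. C1_grad p p'"
proof -
  obtain a where p: "p = (\<lambda>x. \<Sum>i\<le>m. \<Sum>j\<le>m - i. \<Sum>k\<le>m - i - j. a i j k * (x$1)^i * (x$2)^j * (x$3)^k)"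
    using assms unfolding Pk_def by auto
  have "\<exists>r. C1_grad (\<lambda>x. a i j k * (x$1)^i * (x$2)^j * (x$3)^k) r" for i j k
  proof -
    obtain r1 where "C1_grad (\<lambda>x. (x$1)^i) r1" using C1_grad_power[OF C1_grad_coord] by metis
    moreover obtain r2 where "C1_grad (\<lambda>x. (x$2)^j) r2" using C1_grad_power[OF C1_grad_coord] by metis
    moreover obtain r3 where "C1_grad (\<lambda>x. (x$3)^k) r3" using C1_grad_power[OF C1_grad_coord] by metis
    ultimately show ?thesis
      using C1_grad_mult[OF C1_grad_mult[OF C1_grad_mult[OF C1_grad_const[of "a i j k"]]]] by blast
  qed
  then show ?thesis unfolding p by (intro C1_grad_sum)
qed

lemma C1_grad_mvt:
  assumes "C1_grad p p'" "convex B" "y \<in> B" "z \<in> B"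
  shows "\<exists>x\<in>B. p z - p y = p' x \<bullet> (z - y)"
proof -
  have "\<exists>s\<in>{0<..<1::real}. p (y + 1 *\<^sub>R (z - y)) - p (y + 0 *\<^sub>R (z - y))
      = (\<lambda>s h. p' (y + s *\<^sub>R (z - y)) \<bullet> (h *\<^sub>R (z - y))) s (1 - 0)"
  proof (rule mvt_simple)
    fix s :: real
    have "(p \<circ> (\<lambda>s. y + s *\<^sub>R (z - y)) has_derivative
        (\<lambda>v. p' (y + s *\<^sub>R (z - y)) \<bullet> v) \<circ> (\<lambda>h. h *\<^sub>R (z - y))) (at s within {0..1})"
      using assms(1) unfolding C1_grad_def
      by (intro diff_chain_within) (auto intro!: derivative_eq_intros intro: has_derivative_at_withinI)
    then show "((\<lambda>s. p (y + s *\<^sub>R (z - y))) has_derivative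
        (\<lambda>h. p' (y + s *\<^sub>R (z - y)) \<bullet> (h *\<^sub>R (z - y)))) (at s within {0..1})"
      by (simp add: o_def)
  qed simp
  then obtain s where s: "s \<in> {0<..<1}" "p z - p y = p' (y + s *\<^sub>R (z - y)) \<bullet> (z - y)" by auto
  have "y + s *\<^sub>R (z - y) = (1 - s) *\<^sub>R y + s *\<^sub>R z" by (simp add: algebra_simps)
  also have "\<dots> \<in> B" using assms s by (intro convexD) auto
  finally show ?thesis using s by blast
qed

lemma three_indices:
  fixes i :: 3
  shows "\<exists>j k. UNIV = {i, j, k} \<and> i \<noteq> j \<and> i \<noteq> k \<and> j \<noteq> k"
proof -
  have ne: "(1::3) \<noteq> 2" "(1::3) \<noteq> 3" "(2::3) \<noteq> 3" by simp_all
  have "UNIV = {2, 1, 3::3}" "UNIV = {3, 1, 2::3}" unfolding UNIV_3 by blast+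
  then show ?thesis using exhaust_3[of i] UNIV_3 ne by metis
qed

text \<open>A quantitative implicit function theorem without the implicit function: between two
  zeros the mean value theorem gives a vanishing inner product of the gradient with
  \<open>z - y\<close>. Solving for the component whose partial derivative is bounded away from 0
  controls it by the other two, which then serve as the chart.\<close>

lemma hausdorff2_zero_set_local:
  assumes p: "C1_grad p p'" and x0: "p' x0 \<noteq> 0"
  shows "\<exists>e>0. hausdorff2_outer ({x. p x = 0} \<inter> ball x0 e) < top"
proof -
  obtain i where i: "p' x0 $ i \<noteq> 0" using x0 by (auto simp: vec_eq_iff)
  obtain j k where jk: "(UNIV :: 3 set) = {i, j, k}" "i \<noteq> j" "i \<noteq> k" "j \<noteq> k"
    using three_indices[of i] by blast
  \<comment> \<open>Half of the partial derivative at \<open>x0\<close>: where the gradient varies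
    by less than \<open>m\<close>, this partial derivative keeps modulus at least
    \<open>m\<close>.\<close>
  define m where "m = \<bar>p' x0 $ i\<bar> / 2"
  have m: "m > 0" using i by (simp add: m_def)
  obtain e where e: "e > 0" "\<And>x. x \<in> ball x0 e \<Longrightarrow> dist (p' x) (p' x0) < m"
    using p m unfolding C1_grad_def continuous_on_iff by (metis UNIV_I dist_commute mem_ball)
  define B where "B = norm (p' x0) + m"
  have B: "B > 0" using m by (simp add: B_def add_nonneg_pos)
  have low: "\<bar>p' x $ i\<bar> \<ge> m" and up: "\<And>l. \<bar>p' x $ l\<bar> \<le> B" if "x \<in> ball x0 e" for x
  proof -
    have d: "norm (p' x - p' x0) < m" using e(2)[OF that] by (simp add: dist_norm)
    have "\<bar>(p' x - p' x0) $ i\<bar> \<le> norm (p' x - p' x0)" by (rule component_le_norm_cart)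
    then show "\<bar>p' x $ i\<bar> \<ge> m" using d by (simp add: m_def abs_if split: if_splits)
    have "\<bar>p' x $ l\<bar> \<le> norm (p' x)" for l by (rule component_le_norm_cart)
    moreover have "norm (p' x) \<le> B"
      using d norm_triangle_ineq2[of "p' x" "p' x0"] by (simp add: B_def)
    ultimately show "\<bar>p' x $ l\<bar> \<le> B" for l by (meson order_trans)
  qed
  let ?Z = "{x. p x = 0} \<inter> ball x0 e"
  have lip: "dist y z \<le> (1 + B / m) * (\<bar>y$j - z$j\<bar> + \<bar>y$k - z$k\<bar>)" if yz: "y \<in> ?Z" "z \<in> ?Z" for y z
  proof -
    obtain x where x: "x \<in> ball x0 e" "p z - p y = p' x \<bullet> (z - y)"
      using C1_grad_mvt[OF p convex_ball] yz by blast
    let ?d = "z - y"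
    have "0 = p' x $ i * ?d$i + p' x $ j * ?d$j + p' x $ k * ?d$k"
      using x yz jk(2-4) by (simp add: inner_vec_def jk(1))
    then have "\<bar>p' x $ i\<bar> * \<bar>?d$i\<bar> = \<bar>p' x $ j * ?d$j + p' x $ k * ?d$k\<bar>"
      unfolding abs_mult[symmetric] by linarith
    also have "\<dots> \<le> \<bar>p' x $ j\<bar> * \<bar>?d$j\<bar> + \<bar>p' x $ k\<bar> * \<bar>?d$k\<bar>"
      using abs_triangle_ineq by (simp add: abs_mult[symmetric])
    also have "\<dots> \<le> B * \<bar>?d$j\<bar> + B * \<bar>?d$k\<bar>"
      by (intro add_mono mult_right_mono up x) auto
    finally have "\<bar>p' x $ i\<bar> * \<bar>?d$i\<bar> \<le> B * (\<bar>?d$j\<bar> + \<bar>?d$k\<bar>)" by (simp add: algebra_simps)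
    moreover have "m * \<bar>?d$i\<bar> \<le> \<bar>p' x $ i\<bar> * \<bar>?d$i\<bar>" by (intro mult_right_mono low x) auto
    ultimately have "\<bar>?d$i\<bar> \<le> B / m * (\<bar>?d$j\<bar> + \<bar>?d$k\<bar>)" using m by (simp add: field_simps)
    moreover have "dist y z \<le> \<bar>?d$i\<bar> + (\<bar>?d$j\<bar> + \<bar>?d$k\<bar>)"
      using norm_le_l1_cart[of ?d] jk(2-4) by (simp add: jk(1) dist_norm norm_minus_commute)
    ultimately have "dist y z \<le> (1 + B / m) * (\<bar>?d$j\<bar> + \<bar>?d$k\<bar>)" by (simp add: algebra_simps)
    then show ?thesis by (simp add: abs_minus_commute)
  qed
  have "hausdorff2_outer ?Z < top"
  proof (rule hausdorff2_outer_chart_finite[of _ "1 + B / m" "\<lambda>x. x$j" "\<lambda>x. x$k" "norm x0 + e"])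
    have "\<bar>x $ l\<bar> \<le> norm x0 + e" if "x \<in> ?Z" for x l
    proof -
      have "norm x \<le> norm x0 + e"
        using that norm_triangle_ineq2[of x x0] by (simp add: dist_norm norm_minus_commute)
      then show ?thesis using component_le_norm_cart[of x l] by linarith
    qed
    then show "\<And>x. x \<in> ?Z \<Longrightarrow> \<bar>x $ j\<bar> \<le> norm x0 + e" "\<And>x. x \<in> ?Z \<Longrightarrow> \<bar>x $ k\<bar> \<le> norm x0 + e"
      by blast+
    show "1 + B / m > 0" using B m by (simp add: add_pos_pos)
    show "norm x0 + e > 0" using e by (simp add: add_nonneg_pos)
  qed (rule lip)
  then show ?thesis using e by blast
qed

lemma hausdorff2_zero_set_finite:
  assumes p: "C1_grad p p'" and S: "compact S" "\<And>x. x \<in> S \<Longrightarrow> p x = 0 \<Longrightarrow> p' x \<noteq> 0"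
  shows "hausdorff2_outer {x\<in>S. p x = 0} < top"
proof -
  have comp: "compact {x\<in>S. p x = 0}"
  proof -
    have "closed {x. p x = 0}"
      using C1_grad_continuous[OF p] by (intro closed_Collect_eq continuous_on_const)
    then show ?thesis using compact_Int_closed[OF S(1)] by (simp add: Collect_conj_eq)
  qed
  have "\<forall>x\<in>{x\<in>S. p x = 0}. \<exists>e>0. hausdorff2_outer ({x. p x = 0} \<inter> ball x e) < top"
    using hausdorff2_zero_set_local[OF p] S(2) by blast
  then obtain e where e: "\<And>x. x \<in> S \<Longrightarrow> p x = 0 \<Longrightarrow> e x > 0 \<and> hausdorff2_outer ({x. p x = 0} \<inter> ball x (e x)) < top"
    by (metis (mono_tags, lifting) mem_Collect_eq)
  obtain C where C: "C \<subseteq> {x\<in>S. p x = 0}" "finite C" "{x\<in>S. p x = 0} \<subseteq> (\<Union>c\<in>C. ball c (e c))"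
    using e by (rule_tac compactE_image[OF comp, of "{x\<in>S. p x = 0}" "\<lambda>c. ball c (e c)"]) auto
  have "hausdorff2_outer {x\<in>S. p x = 0} \<le> hausdorff2_outer (\<Union>c\<in>C. {x. p x = 0} \<inter> ball c (e c))"
    using C by (intro hausdorff2_outer_mono) auto
  also have "\<dots> < top" using C e by (intro hausdorff2_outer_finite_Union) auto
  finally show ?thesis .
qed

subsection \<open>Signed distance and closest point projection\<close>

text \<open>Uniqueness of the derivative at boundary points of a convex set with interior.
  One-dimensional uniqueness on segments kills \<open>L\<close> on all directions
  \<open>y - x\<close> pointing into \<open>S\<close>, and differences of such directions fill a
  ball.\<close>

lemma has_derivative_zero_convex:
  fixes x c :: "'a::real_normed_vector" and L :: "'a \<Rightarrow> real"
  assumes L: "((\<lambda>_. 0) has_derivative L) (at x within S)"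
    and S: "convex S" "x \<in> S" "ball c r \<subseteq> S" "r > 0"
  shows "L v = 0"
proof -
  interpret L: bounded_linear L using L by (rule has_derivative_bounded_linear)
  have z: "L (y - x) = 0" if y: "y \<in> S" for y
  proof -
    let ?g = "\<lambda>h::real. x + h *\<^sub>R (y - x)"
    have gS: "?g ` {0..1} \<subseteq> S"
    proof clarify
      fix h :: real assume "h \<in> {0..1}"
      then have "(1 - h) *\<^sub>R x + h *\<^sub>R y \<in> S" by (intro convexD S y) auto
      then show "?g h \<in> S" by (simp add: algebra_simps)
    qed
    have "(?g has_derivative (\<lambda>h. h *\<^sub>R (y - x))) (at 0 within {0..1})"
      by (auto intro!: derivative_eq_intros)
    moreover have "((\<lambda>_. 0) has_derivative L) (at (?g 0) within ?g ` {0..1})"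
      using has_derivative_subset[OF L gS] by simp
    ultimately have "((\<lambda>_. 0) \<circ> ?g has_derivative L \<circ> (\<lambda>h. h *\<^sub>R (y - x))) (at 0 within {0..1})"
      by (rule diff_chain_within)
    then have "((\<lambda>_::real. 0::real) has_derivative (\<lambda>h. L (h *\<^sub>R (y - x)))) (at 0 within cbox 0 1)"
      by (simp add: o_def)
    then have "(\<lambda>h. L (h *\<^sub>R (y - x))) = (\<lambda>h. 0)"
      by (rule frechet_derivative_unique_within_closed_interval[rotated 2]) auto
    then show ?thesis using fun_cong[of _ _ "1::real"] by fastforce
  qed
  \<comment> \<open>Small enough for \<open>c + h *\<^sub>R v\<close> to stay in the ball; the added
    1 covers \<open>v = 0\<close>.\<close>
  define h where "h = r / (2 * (norm v + 1))"
  have nv: "norm v + 1 > 0" by (simp add: add_nonneg_pos)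
  have h: "h > 0" using S(4) nv by (simp add: h_def)
  have "norm (h *\<^sub>R v) = r * (norm v / (2 * (norm v + 1)))" using S(4) nv by (simp add: h_def)
  also have "\<dots> < r * 1" using S(4) nv by (intro mult_strict_left_mono) (auto simp: divide_less_eq)
  finally have "c + h *\<^sub>R v \<in> S" using S(3) by (auto simp: dist_norm)
  moreover have "c \<in> S" using S(3,4) by auto
  ultimately have "L ((c + h *\<^sub>R v) - x) - L (c - x) = 0" using z by simp
  then have "h * L v = 0" by (simp add: L.diff L.add L.scaleR)
  then show ?thesis using h by simp
qed

text \<open>Ties the derivative selected by \<open>frechet_derivative\<close> to any derivative at
  hand, on the faces of a tetrahedron as well.\<close>

lemma grad_within_inner:
  assumes f: "(f has_derivative f') (at x within S)"
    and S: "convex S" "x \<in> S" "ball c r \<subseteq> S" "r > 0"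
  shows "grad_within S f x \<bullet> v = f' v"
proof -
  interpret f': bounded_linear f' using f by (rule has_derivative_bounded_linear)
  have "(f has_derivative frechet_derivative f (at x within S)) (at x within S)"
    using f frechet_derivative_works differentiable_def by blast
  from has_derivative_diff[OF this f]
  have "((\<lambda>_. 0) has_derivative (\<lambda>v. frechet_derivative f (at x within S) v - f' v)) (at x within S)"
    by simp
  from has_derivative_zero_convex[OF this S]
  have eq: "frechet_derivative f (at x within S) v = f' v" for v by simp
  have "f' v = f' (\<Sum>i\<in>UNIV. v $ i *\<^sub>R axis i 1)"
    using basis_expansion[of v] by (simp add: scalar_mult_eq_scaleR)
  also have "\<dots> = (\<Sum>i\<in>UNIV. v $ i * f' (axis i 1))"
    by (simp add: f'.sum f'.scaleR)
  finally show ?thesis by (simp add: grad_within_def inner_vec_def mult.commute eq)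
qed

lemma grad_inner:
  assumes "(f has_derivative f') (at x)"
  shows "grad f x \<bullet> v = f' v"
  by (rule grad_within_inner[OF assms convex_UNIV UNIV_I subset_UNIV zero_less_one])

text \<open>A ball that misses \<open>M\<close> is connected, hence lies in one component of the
  complement, so the sign is constant on it.\<close>

lemma signed_distance_near:
  assumes "closed M" "y \<notin> M"
  obtains s e where "\<bar>s\<bar> = 1" "e > 0" "\<And>z. z \<in> ball y e \<Longrightarrow> signed_distance M z = s * infdist z M"
proof -
  obtain e where e: "e > 0" "ball y e \<subseteq> - M"
    using assms by (meson ComplI open_Compl open_contains_ball)
  have "z \<in> inside M \<longleftrightarrow> y \<in> inside M" if "z \<in> ball y e" for z
  proof -
    have "connected_component (- M) y z"
      using e that convex_connected[OF convex_ball] by (auto simp: connected_component_def intro!: exI[of _ "ball y e"])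
    then show ?thesis using inside_same_component connected_component_sym by metis
  qed
  then have "signed_distance M z = (if y \<in> inside M then -1 else 1) * infdist z M" if "z \<in> ball y e" for z
    using that by (simp add: signed_distance_def)
  then show ?thesis using that[of "if y \<in> inside M then -1 else 1" e] e by simp
qed

text \<open>The distance is 1-Lipschitz, so \<open>norm g \<le> 1\<close>, yet it decreases at unit
  rate along the segment to a nearest point. This is the equality case of Cauchy-Schwarz and forces
  \<open>y - q = f y *\<^sub>R g\<close>. No uniqueness of the nearest point is presupposed.\<close>

lemma closest_point_signed_distance:
  assumes M: "closed M" "M \<noteq> {}" "y \<notin> M"
    and N: "open N" "y \<in> N" "\<And>z. z \<in> N \<Longrightarrow> f z = signed_distance M z"
    and f: "(f has_derivative (\<lambda>v. g \<bullet> v)) (at y)"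
  shows "closest_point M y = y - f y *\<^sub>R g \<and> norm g = 1"
proof -
  obtain s e1 where s: "\<bar>s\<bar> = 1" and e1: "e1 > 0" "\<And>z. z \<in> ball y e1 \<Longrightarrow> signed_distance M z = s * infdist z M"
    using signed_distance_near M by metis
  obtain e2 where e2: "e2 > 0" "ball y e2 \<subseteq> N" using N(1,2) by (meson open_contains_ball)
  define e where "e = min e1 e2"
  have e: "e > 0" and fe: "\<And>z. z \<in> ball y e \<Longrightarrow> f z = s * infdist z M"
    using e1 e2 N(3) by (auto simp: e_def subset_eq)
  define q where "q = closest_point M y"
  define r where "r = infdist y M"
  have q: "q \<in> M" unfolding q_def by (rule closest_point_in_set[OF M(1,2)])
  have dq: "dist y q = r"
  proof (rule antisym)
    obtain z where "z \<in> M" "infdist y M = dist y z" using infdist_attains_inf[OF M(1,2)] by blast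
    then show "dist y q \<le> r" unfolding q_def r_def using closest_point_le[OF M(1)] by simp
    show "r \<le> dist y q" unfolding r_def by (rule infdist_le[OF q])
  qed
  have r: "r > 0" using dq q M(3) by (auto simp flip: dq)
  have lim: "((\<lambda>h. (f (y + h *\<^sub>R v) - f y) / h) \<longlongrightarrow> g \<bullet> v) (at 0)" for v
  proof -
    have "(f \<circ> (\<lambda>h. y + h *\<^sub>R v) has_derivative (\<lambda>v. g \<bullet> v) \<circ> (\<lambda>h. h *\<^sub>R v)) (at 0)"
      by (rule diff_chain_at) (use f in \<open>auto intro!: derivative_eq_intros\<close>)
    then have "((\<lambda>h. f (y + h *\<^sub>R v)) has_field_derivative g \<bullet> v) (at 0)"
      by (simp add: has_field_derivative_def o_def mult_commute_abs)
    then show ?thesis by (simp add: DERIV_def)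
  qed
  have near: "\<forall>\<^sub>F h in at 0. y + h *\<^sub>R v \<in> ball y e" for v
  proof -
    have "((\<lambda>h. y + h *\<^sub>R v) \<longlongrightarrow> y + 0 *\<^sub>R v) (at 0)" by (intro tendsto_intros)
    then show ?thesis using e by (auto dest!: topological_tendstoD[where S = "ball y e"])
  qed
  have ne0: "\<forall>\<^sub>F h in at 0. h \<noteq> (0::real)" by (simp add: eventually_at_filter)
  have lt1: "\<forall>\<^sub>F h in at_right 0. h < (1::real)" by (rule eventually_at_rightI[of 0 1]) auto
  have right: "\<forall>\<^sub>F h in at_right 0. y + h *\<^sub>R v \<in> ball y e" for v
    using near[of v] at_le[of "{0<..}" UNIV "0::real"] filter_leD by blast
  \<comment> \<open>Difference quotients in the direction \<open>g\<close> itself are at most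
    \<open>norm g\<close> by the Lipschitz bound.\<close>
  have "g \<bullet> g \<le> norm g"
  proof (rule tendsto_upperbound[OF lim])
    show "\<forall>\<^sub>F h in at 0. (f (y + h *\<^sub>R g) - f y) / h \<le> norm g"
      using near[of g] ne0
    proof eventually_elim
      case (elim h)
      have "\<bar>f (y + h *\<^sub>R g) - f y\<bar> = \<bar>s\<bar> * \<bar>infdist (y + h *\<^sub>R g) M - infdist y M\<bar>"
        using fe elim e by (simp add: abs_mult[symmetric] right_diff_distrib)
      also have "\<dots> \<le> \<bar>h\<bar> * norm g"
        using s infdist_triangle_abs[of "y + h *\<^sub>R g" M y] by (simp add: dist_norm)
      finally have "\<bar>(f (y + h *\<^sub>R g) - f y) / h\<bar> \<le> norm g"
        using elim by (simp add: abs_divide divide_le_eq mult.commute)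
      then show ?case by linarith
    qed
  qed simp
  then have g1: "norm g \<le> 1"
    by (cases "g = 0") (auto simp: power2_norm_eq_inner[symmetric] power2_eq_square)
  have fy: "f y = s * r" using fe e by (simp add: r_def)
  \<comment> \<open>A one-sided limit, because only \<open>0 < h < 1\<close> gives points between
    \<open>y\<close> and \<open>q\<close>. There two triangle inequalities pin the distance to
    \<open>(1 - h) * r\<close>.\<close>
  have "g \<bullet> (q - y) = - f y"
  proof (rule tendsto_unique[of "at_right (0::real)"])
    show "((\<lambda>h. (f (y + h *\<^sub>R (q - y)) - f y) / h) \<longlongrightarrow> g \<bullet> (q - y)) (at_right 0)"
      by (rule tendsto_within_subset[OF lim]) simp
    have "\<forall>\<^sub>F h in at_right 0. (f (y + h *\<^sub>R (q - y)) - f y) / h = - f y"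
      using eventually_at_right_less[of "0::real"] lt1 right[of "q - y"]
    proof eventually_elim
      case (elim h)
      define z where "z = y + h *\<^sub>R (q - y)"
      have "z - q = (1 - h) *\<^sub>R (y - q)" by (simp add: z_def algebra_simps)
      then have "dist z q = (1 - h) * r" using elim dq by (simp add: dist_norm)
      moreover have "dist y z = h * r" using elim dq by (simp add: dist_norm z_def norm_minus_commute)
      moreover have "infdist z M \<le> dist z q" by (rule infdist_le[OF q])
      moreover have "infdist y M \<le> infdist z M + dist y z" by (rule infdist_triangle)
      ultimately have iz: "infdist z M = (1 - h) * r" by (simp add: r_def algebra_simps)
      have fz: "f z = s * infdist z M" using fe[of z] elim by (simp add: z_def)
      have "f z - f y = - h * f y" unfolding fz iz fy by (simp add: algebra_simps)
      then show ?case using elim by (simp add: z_def)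
    qed
    then show "((\<lambda>h. (f (y + h *\<^sub>R (q - y)) - f y) / h) \<longlongrightarrow> - f y) (at_right 0)"
      by (rule tendsto_eventually)
  qed simp
  then have gq: "g \<bullet> (y - q) = f y" by (simp add: inner_diff_right)
  have sq: "f y * f y = r * r"
    using s by (auto simp: fy abs_if split: if_splits)
  have "(norm ((y - q) - f y *\<^sub>R g))\<^sup>2 = (norm (y - q))\<^sup>2 - 2 * f y * (g \<bullet> (y - q)) + (f y)\<^sup>2 * (norm g)\<^sup>2"
    unfolding power2_norm_eq_inner by (simp add: inner_simps inner_commute algebra_simps power2_eq_square)
  also have "\<dots> = r * r - 2 * (f y * f y) + (f y * f y) * (norm g)\<^sup>2"
    unfolding gq using dq by (simp add: dist_norm power2_eq_square)
  also have "\<dots> = r * r * ((norm g)\<^sup>2 - 1)" unfolding sq by (simp add: algebra_simps)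
  also have "\<dots> \<le> 0" using g1 r by (simp add: mult_le_0_iff power_le_one)
  finally have eq: "y - q = f y *\<^sub>R g" by simp
  then have "r = \<bar>f y\<bar> * norm g" using dq by (simp add: dist_norm)
  also have "\<bar>f y\<bar> = r" using fy s r by (simp add: abs_mult)
  finally have "norm g = 1" using r by simp
  then show ?thesis using eq by (simp add: q_def algebra_simps)
qed

text \<open>A local defining function would vanish on an open set and have zero gradient there.
  Consequently every surface point is a limit of points off the surface.\<close>

lemma smooth_surface_interior:
  assumes "smooth_surface M" "y \<in> M" "open B" "y \<in> B"
  shows "\<exists>z\<in>B. z \<notin> M"
proof (rule ccontr)
  assume "\<not> ?thesis"
  then have BM: "B \<subseteq> M" by blast
  obtain U f where U: "y \<in> U" "smooth_on U f" "\<forall>y\<in>U. grad f y \<noteq> 0" "M \<inter> U = {y\<in>U. f y = 0}"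
    using assms(1,2) unfolding smooth_surface_def by meson
  have "open (B \<inter> U)" using U(2) assms(3) by (auto simp: smooth_on_def)
  then have "(f has_derivative (\<lambda>v. 0)) (at y)"
    by (rule has_derivative_transform_within_open[rotated, of _ y "\<lambda>_. 0"]) (use U BM assms in auto)
  then have "grad f y \<bullet> grad f y = 0" by (rule grad_inner)
  then show False using U by auto
qed

subsection \<open>Uniform bound for the projected velocity\<close>

text \<open>One number bounds both the value and the derivative at a point, so that sums, products
  and compositions yield explicit constants that do not involve the point.\<close>

definition C1_bound :: "('a::real_normed_vector \<Rightarrow> 'b::real_normed_vector) \<Rightarrow> 'a \<Rightarrow> real \<Rightarrow> bool" where
  "C1_bound f x L \<longleftrightarrow> norm (f x) \<le> L \<and>
     (\<exists>f'. (f has_derivative f') (at x) \<and> (\<forall>v. norm (f' v) \<le> L * norm v))"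

lemma C1_bound_nonneg: "C1_bound f x L \<Longrightarrow> 0 \<le> L"
  unfolding C1_bound_def using norm_ge_zero order_trans by blast

lemma C1_bound_isCont: "C1_bound f x L \<Longrightarrow> isCont f x"
  unfolding C1_bound_def by (elim conjE exE) (rule has_derivative_continuous)

lemma C1_bound_const: "C1_bound (\<lambda>x. c) x (norm c)"
  unfolding C1_bound_def by (auto intro!: exI[of _ "\<lambda>_. 0"])

lemma C1_bound_id:
  assumes "norm x \<le> R"
  shows "C1_bound (\<lambda>x. x) x (R + 1)"
proof -
  have "R \<ge> 0" using assms norm_ge_zero order_trans by blast
  then show ?thesis
    using assms unfolding C1_bound_def by (auto intro!: exI[of _ "\<lambda>v. v"] simp: distrib_right)
qed

lemma C1_bound_add:
  assumes "C1_bound f x A" "C1_bound g x B"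
  shows "C1_bound (\<lambda>x. f x + g x) x (A + B)"
proof -
  obtain f' g' where d: "(f has_derivative f') (at x)" "(g has_derivative g') (at x)"
    and n: "\<And>v. norm (f' v) \<le> A * norm v" "\<And>v. norm (g' v) \<le> B * norm v"
    using assms unfolding C1_bound_def by blast
  have "norm (f' v + g' v) \<le> (A + B) * norm v" for v
    using norm_triangle_ineq[of "f' v" "g' v"] n[of v] by (simp add: distrib_right)
  moreover have "norm (f x + g x) \<le> A + B"
    using assms norm_triangle_mono unfolding C1_bound_def by blast
  ultimately show ?thesis
    unfolding C1_bound_def using has_derivative_add[OF d] by blast
qed

lemma C1_bound_bilinear:
  fixes prod (infixl \<open>\<star>\<close> 70)
  assumes "bounded_bilinear prod" and le: "\<And>a b. norm (a \<star> b) \<le> norm a * norm b"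
    and f: "C1_bound f x A" and g: "C1_bound g x B"
  shows "C1_bound (\<lambda>x. f x \<star> g x) x (2 * A * B)"
proof -
  interpret bounded_bilinear prod by fact
  obtain f' g' where d: "(f has_derivative f') (at x)" "(g has_derivative g') (at x)"
    and n: "\<And>v. norm (f' v) \<le> A * norm v" "\<And>v. norm (g' v) \<le> B * norm v"
    using f g unfolding C1_bound_def by blast
  have fg: "norm (f x) \<le> A" "norm (g x) \<le> B" using f g by (auto simp: C1_bound_def)
  note nn = C1_bound_nonneg[OF f] C1_bound_nonneg[OF g]
  have "norm (f x \<star> g' v + f' v \<star> g x) \<le> 2 * A * B * norm v" for v
  proof -
    have "norm (f x \<star> g' v) \<le> A * (B * norm v)"
      by (rule order_trans[OF le]) (intro mult_mono fg n nn norm_ge_zero)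
    moreover have "norm (f' v \<star> g x) \<le> (A * norm v) * B"
      by (rule order_trans[OF le]) (intro mult_mono fg n nn norm_ge_zero mult_nonneg_nonneg)
    ultimately show ?thesis
      using norm_triangle_ineq[of "f x \<star> g' v" "f' v \<star> g x"] by (simp add: algebra_simps)
  qed
  moreover have "norm (f x \<star> g x) \<le> 2 * A * B"
  proof -
    have "norm (f x \<star> g x) \<le> A * B"
      by (rule order_trans[OF le]) (intro mult_mono fg nn norm_ge_zero)
    also have "\<dots> \<le> 2 * A * B" using nn by (simp add: mult_nonneg_nonneg)
    finally show ?thesis .
  qed
  ultimately show ?thesis unfolding C1_bound_def using FDERIV[OF d] by blast
qed

lemma C1_bound_scaleR:
  "C1_bound f x A \<Longrightarrow> C1_bound g x B \<Longrightarrow> C1_bound (\<lambda>x. f x *\<^sub>R g x) x (2 * A * B)"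
  by (rule C1_bound_bilinear[OF bounded_bilinear_scaleR]) auto

lemma C1_bound_inner:
  "C1_bound f x A \<Longrightarrow> C1_bound g x B \<Longrightarrow> C1_bound (\<lambda>x. f x \<bullet> g x) x (2 * A * B)"
  by (rule C1_bound_bilinear[OF bounded_bilinear_inner]) (auto simp: Cauchy_Schwarz_ineq2)

lemma C1_bound_minus:
  assumes "C1_bound f x A" shows "C1_bound (\<lambda>x. - f x) x A"
proof -
  obtain f' where d: "(f has_derivative f') (at x)" and n: "\<And>v. norm (f' v) \<le> A * norm v"
    using assms unfolding C1_bound_def by blast
  show ?thesis
    using assms n has_derivative_minus[OF d] unfolding C1_bound_def by (auto intro!: exI[of _ "\<lambda>v. - f' v"])
qed

lemma C1_bound_sum:
  assumes "finite I" "\<And>i. i \<in> I \<Longrightarrow> C1_bound (f i) x (A i)"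
  shows "C1_bound (\<lambda>x. \<Sum>i\<in>I. f i x) x (\<Sum>i\<in>I. A i)"
  using assms
proof (induction I rule: finite_induct)
  case empty
  then show ?case using C1_bound_const[of 0] by simp
next
  case (insert i I)
  then show ?case using C1_bound_add[of "f i" x "A i"] by simp
qed

text \<open>The chain rule alone gives \<open>B * A\<close>; the summand 1 is there because the
  constant must also dominate the value, which is bounded by \<open>B\<close>.\<close>

lemma C1_bound_compose:
  assumes f: "C1_bound f x A" and g: "C1_bound g (f x) B"
  shows "C1_bound (\<lambda>x. g (f x)) x (B * (1 + A))"
proof -
  obtain f' g' where d: "(f has_derivative f') (at x)" "(g has_derivative g') (at (f x))"
    and n: "\<And>v. norm (f' v) \<le> A * norm v" "\<And>v. norm (g' v) \<le> B * norm v"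
    using f g unfolding C1_bound_def by blast
  note nn = C1_bound_nonneg[OF f] C1_bound_nonneg[OF g]
  have "norm (g' (f' v)) \<le> B * (1 + A) * norm v" for v
  proof -
    have "norm (g' (f' v)) \<le> B * (A * norm v)"
      by (rule order_trans[OF n(2)]) (intro mult_left_mono n nn)
    also have "\<dots> \<le> B * ((1 + A) * norm v)" using nn by (intro mult_left_mono mult_right_mono) auto
    finally show ?thesis by (simp add: mult.assoc)
  qed
  moreover have "norm (g (f x)) \<le> B * (1 + A)"
  proof -
    have "norm (g (f x)) \<le> B" using g by (simp add: C1_bound_def)
    also have "\<dots> \<le> B * (1 + A)" using nn by (simp add: algebra_simps)
    finally show ?thesis .
  qed
  ultimately show ?thesis
    unfolding C1_bound_def using diff_chain_at[OF d] by (auto simp: o_def)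
qed

lemma C1_bound_slice:
  assumes "C1_bound f (x, t) L"
  shows "C1_bound (\<lambda>y. f (y, t)) x L"
proof -
  obtain f' where d: "(f has_derivative f') (at (x, t))" and n: "\<And>v. norm (f' v) \<le> L * norm v"
    using assms unfolding C1_bound_def by blast
  have "(f \<circ> (\<lambda>y. (y, t)) has_derivative f' \<circ> (\<lambda>v. (v, 0))) (at x)"
    by (rule diff_chain_at) (use d in \<open>auto intro!: derivative_eq_intros\<close>)
  moreover have "norm (f' (v, 0)) \<le> L * norm v" for v
    using n[of "(v, 0)"] by (simp add: norm_Pair)
  ultimately show ?thesis using assms unfolding C1_bound_def by (auto simp: o_def)
qed

lemma Ck_on_C1_bound:
  fixes f :: "'a::euclidean_space \<Rightarrow> 'b::real_normed_vector"
  assumes "Ck_on (Suc 0) W f" "open W" "compact K" "K \<subseteq> W"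
  shows "\<exists>L. \<forall>z\<in>K. C1_bound f z L"
proof -
  have d: "f differentiable_on W" and c: "\<And>b. b \<in> Basis \<Longrightarrow> continuous_on W (\<lambda>x. frechet_derivative f (at x) b)"
    using assms(1) by auto
  have bdd: "\<exists>M\<ge>0. \<forall>z\<in>K. norm (h z) \<le> M" if "continuous_on W h" for h :: "'a \<Rightarrow> 'b"
  proof -
    have "bounded (h ` K)"
      by (intro compact_imp_bounded compact_continuous_image assms continuous_on_subset[OF that])
    then show ?thesis by (metis bounded_pos image_eqI less_imp_le)
  qed
  obtain M0 where M0: "M0 \<ge> 0" "\<And>z. z \<in> K \<Longrightarrow> norm (f z) \<le> M0"
    using bdd[OF differentiable_imp_continuous_on[OF d]] by blast
  have "\<forall>b\<in>Basis. \<exists>M\<ge>0. \<forall>z\<in>K. norm (frechet_derivative f (at z) b) \<le> M" using bdd c by blast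
  then obtain M where M: "\<And>b. b \<in> Basis \<Longrightarrow> M b \<ge> 0"
    "\<And>b z. b \<in> Basis \<Longrightarrow> z \<in> K \<Longrightarrow> norm (frechet_derivative f (at z) b) \<le> M b"
    by (metis (no_types))
  define L where "L = M0 + (\<Sum>b\<in>Basis. M b)"
  have "C1_bound f z L" if z: "z \<in> K" for z
  proof -
    let ?f' = "frechet_derivative f (at z)"
    have "f differentiable (at z)"
      using d z assms(2,4) by (auto simp: differentiable_on_eq_differentiable_at)
    then have der: "(f has_derivative ?f') (at z)" by (simp add: frechet_derivative_works)
    then interpret f': bounded_linear ?f' by (rule has_derivative_bounded_linear)
    have "norm (?f' v) \<le> L * norm v" for v
    proof -
      have "?f' v = ?f' (\<Sum>b\<in>Basis. (v \<bullet> b) *\<^sub>R b)" by (simp add: euclidean_representation)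
      also have "\<dots> = (\<Sum>b\<in>Basis. (v \<bullet> b) *\<^sub>R ?f' b)" by (simp add: f'.sum f'.scaleR)
      also have "norm \<dots> \<le> (\<Sum>b\<in>Basis. norm v * M b)"
      proof (rule sum_norm_le)
        fix b :: 'a assume b: "b \<in> Basis"
        show "norm ((v \<bullet> b) *\<^sub>R ?f' b) \<le> norm v * M b"
          unfolding norm_scaleR using Basis_le_norm[OF b] M b z by (intro mult_mono) auto
      qed
      also have "\<dots> = (\<Sum>b\<in>Basis. M b) * norm v" by (simp add: sum_distrib_left[symmetric] mult.commute[of _ "norm v"])
      also have "\<dots> \<le> L * norm v" using M0 by (intro mult_right_mono) (auto simp: L_def)
      finally show ?thesis .
    qed
    moreover have "norm (f z) \<le> L" using M0(2)[OF z] M(1) by (simp add: L_def sum_nonneg add_increasing2)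
    ultimately show ?thesis unfolding C1_bound_def using der by blast
  qed
  then show ?thesis by blast
qed

text \<open>Near the surface the projection is an expression in the level set function and its
  gradient, and on the surface this gradient is the normal. The projected field is therefore a
  composition of smooth space-time fields, whose bounds on a compact cylinder are uniform in
  \<open>x\<close> and \<open>t\<close>.\<close>

lemma projected_velocity_C1_bound:
  assumes P: "is_evolving_surface P" and cpt: "compact (closure (dom P))"
  shows "\<exists>C\<ge>0. \<forall>t\<in>{0..Tend P}. \<forall>x\<in>nbhd_at P t. \<exists>f'.
    ((\<lambda>y. vel P (closest_point (surf P t) y) t - (1/2) *\<^sub>R wT P (closest_point (surf P t) y) t)
      has_derivative f') (at x) \<and> (\<forall>v. norm (f' v) \<le> C * norm v)"
proof -
  define K where "K = closure (dom P) \<times> {0..Tend P}"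
  define V where "V = (\<lambda>(x, t). vel P x t)"
  define \<Phi> where "\<Phi> = (\<lambda>(x, t). lvl P x t)"
  \<comment> \<open>Spatial gradient read off the space-time derivative: smoothness is given jointly
    in \<open>(x, t)\<close>, and only joint bounds are uniform in time.\<close>
  define G :: "point \<times> real \<Rightarrow> point" where
    "G z = (\<Sum>i\<in>UNIV. frechet_derivative \<Phi> (at z) (axis i 1, 0) *\<^sub>R axis i 1)" for z
  obtain W where W: "K \<subseteq> W" "smooth_on W V" "smooth_on W \<Phi>"
    using P unfolding is_evolving_surface_def K_def V_def \<Phi>_def by blast
  have oW: "open W" using W by (simp add: smooth_on_def)
  have cK: "compact K" unfolding K_def by (intro compact_Times cpt compact_Icc)
  have "Ck_on (Suc 0) W V" "Ck_on (Suc 0) W \<Phi>" "Ck_on (Suc (Suc 0)) W \<Phi>"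
    using W unfolding smooth_on_def by blast+
  note Ck = this
  obtain LV where LV: "\<And>z. z \<in> K \<Longrightarrow> C1_bound V z LV"
    using Ck_on_C1_bound[OF Ck(1) oW cK W(1)] by blast
  obtain LP where LP: "\<And>z. z \<in> K \<Longrightarrow> C1_bound \<Phi> z LP"
    using Ck_on_C1_bound[OF Ck(2) oW cK W(1)] by blast
  have "\<exists>L. \<forall>z\<in>K. C1_bound (\<lambda>z. frechet_derivative \<Phi> (at z) (axis i 1, 0)) z L" for i
  proof (rule Ck_on_C1_bound[OF _ oW cK W(1)])
    have "((axis i 1, 0) :: point \<times> real) \<in> Basis" by (simp add: Basis_prod_def)
    then show "Ck_on (Suc 0) W (\<lambda>z. frechet_derivative \<Phi> (at z) (axis i 1, 0))"
      using Ck(3) by (simp only: Ck_on.simps(2)[of "Suc 0"])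
  qed
  then obtain Lg where Lg: "\<And>i z. z \<in> K \<Longrightarrow> C1_bound (\<lambda>z. frechet_derivative \<Phi> (at z) (axis i 1, 0)) z (Lg i)"
    by metis
  define LG where "LG = (\<Sum>i\<in>UNIV. 2 * Lg i * norm (axis i 1 :: point))"
  have LG: "C1_bound G z LG" if "z \<in> K" for z
    unfolding G_def LG_def by (intro C1_bound_sum C1_bound_scaleR Lg that C1_bound_const) simp
  obtain R where R: "\<And>x. x \<in> closure (dom P) \<Longrightarrow> norm x \<le> R"
    using compact_imp_bounded[OF cpt] unfolding bounded_iff by blast
  \<comment> \<open>With normal \<open>n\<close> and velocity \<open>w\<close>, subtracting half of
    the tangential part \<open>w - (w \<bullet> n) *\<^sub>R n\<close> from \<open>w\<close> leaves
    half of \<open>w + (w \<bullet> n) *\<^sub>R n\<close>.\<close>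
  define H where "H z = (1/2) *\<^sub>R (V z + (V z \<bullet> G z) *\<^sub>R G z)" for z
  define LH where "LH = 2 * norm (1/2::real) * (LV + 2 * (2 * LV * LG) * LG)"
  have LH: "C1_bound H z LH" if "z \<in> K" for z
    unfolding H_def LH_def
    by (intro C1_bound_scaleR C1_bound_add C1_bound_inner C1_bound_const LV LG that)
  define Lp where "Lp = (R + 1) + 2 * LP * LG"
  define C where "C = LH * (1 + Lp)"
  have main: "\<exists>f'. ((\<lambda>y. vel P (closest_point (surf P t) y) t - (1/2) *\<^sub>R wT P (closest_point (surf P t) y) t)
      has_derivative f') (at x) \<and> (\<forall>v. norm (f' v) \<le> C * norm v)"
    if t: "t \<in> {0..Tend P}" and x: "x \<in> nbhd_at P t" for t x
  proof -
    let ?M = "surf P t" and ?N = "nbhd_at P t"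
    have S: "compact ?M" "?M \<noteq> {}" "smooth_surface ?M" "?M \<subseteq> ?N" "?N \<subseteq> dom P"
        "?M = {x\<in>dom P. lvl P x t = 0}" "\<And>x. x \<in> ?N \<Longrightarrow> lvl P x t = signed_distance ?M x"
      using P t unfolding is_evolving_surface_def by blast+
    have cM: "closed ?M" by (rule compact_imp_closed[OF S(1)])
    have NK: "(y, t) \<in> K" if "y \<in> ?N" for y
      using that S(5) t closure_subset by (fastforce simp: K_def)
    have oN: "open ?N"
    proof -
      have "?N = (\<lambda>x. (x, t)) -` nbhd P" by (auto simp: nbhd_at_def)
      moreover have "open (nbhd P)" using P by (simp add: is_evolving_surface_def)
      ultimately show ?thesis by (auto intro!: open_vimage continuous_intros)
    qed
    have der: "((\<lambda>y. lvl P y t) has_derivative (\<lambda>v. G (y, t) \<bullet> v)) (at y)" if "y \<in> ?N" for y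
    proof -
      let ?F = "frechet_derivative \<Phi> (at (y, t))"
      have "\<Phi> differentiable (at (y, t))"
        using LP[OF NK[OF that]] unfolding C1_bound_def differentiable_def by blast
      then have d: "(\<Phi> has_derivative ?F) (at (y, t))" by (simp add: frechet_derivative_works)
      have "(\<Phi> \<circ> (\<lambda>y. (y, t)) has_derivative ?F \<circ> (\<lambda>v. (v, 0))) (at y)"
        by (rule diff_chain_at) (use d in \<open>auto intro!: derivative_eq_intros\<close>)
      then have d2: "((\<lambda>y. lvl P y t) has_derivative (\<lambda>v. ?F (v, 0))) (at y)"
        by (simp add: o_def \<Phi>_def)
      have "G (y, t) = grad (\<lambda>y. lvl P y t) y"
        by (simp add: vec_eq_iff G_def grad_within_def frechet_derivative_at[OF d2, symmetric]
            axis_def if_distrib sum.delta cong: if_cong)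
      then show ?thesis using d2 grad_inner[OF d2] by simp
    qed
    have gradG: "grad (\<lambda>y. lvl P y t) y = G (y, t)" if "y \<in> ?N" for y
      using grad_inner[OF der[OF that]] vector_eq_rdot by blast
    have cp: "closest_point ?M y = y - lvl P y t *\<^sub>R G (y, t) \<and> norm (G (y, t)) = 1"
      if "y \<in> ?N" "y \<notin> ?M" for y
      by (rule closest_point_signed_distance[OF cM S(2) that(2) oN that(1) S(7) der[OF that(1)]])
    have proj: "closest_point ?M y = y - lvl P y t *\<^sub>R G (y, t)" if "y \<in> ?N" for y
    proof (cases "y \<in> ?M")
      case True
      then show ?thesis using S(6) closest_point_self[of y ?M] by auto
    qed (use cp that in blast)
    have G1: "norm (G (y, t)) = 1" if y: "y \<in> ?M" for y
    proof (rule ccontr)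
      assume ne: "norm (G (y, t)) \<noteq> 1"
      have "isCont (\<lambda>y. G (y, t)) y"
        by (rule C1_bound_isCont[OF C1_bound_slice[OF LG[OF NK[OF subsetD[OF S(4) y]]]]])
      then have "isCont (\<lambda>y. norm (G (y, t))) y" by (rule continuous_norm)
      then have "\<exists>B. open B \<and> y \<in> B \<and> (\<forall>z\<in>B. norm (G (z, t)) \<in> - {1})"
        by (rule continuous_at_open[THEN iffD1, rule_format]) (use ne in auto)
      then obtain B where B: "open B" "y \<in> B" "\<And>z. z \<in> B \<Longrightarrow> norm (G (z, t)) \<noteq> 1"
        by auto
      obtain z where "z \<in> B \<inter> ?N" "z \<notin> ?M"
        using smooth_surface_interior[OF S(3) y, of "B \<inter> ?N"] B oN y S(4) by blast
      then show False using cp B by blast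
    qed
    define p where "p y = y - lvl P y t *\<^sub>R G (y, t)" for y
    have pM: "p y \<in> ?M" if "y \<in> ?N" for y
      using closest_point_in_set[OF cM S(2), of y] proj[OF that] by (simp add: p_def)
    have eq: "vel P (closest_point ?M y) t - (1/2) *\<^sub>R wT P (closest_point ?M y) t = H (p y, t)"
      if "y \<in> ?N" for y
    proof -
      have "nrm P (p y) t = G (p y, t)"
        using gradG G1 pM[OF that] S(4) by (auto simp: nrm_def Let_def)
      then show ?thesis
        unfolding proj[OF that] p_def[symmetric]
        by (simp add: H_def wT_def wN_def V_def algebra_simps flip: scaleR_add_left)
    qed
    have "C1_bound p x Lp"
    proof -
      have "norm x \<le> R" using R S(5) x closure_subset by blast
      moreover have "C1_bound (\<lambda>y. lvl P y t) x LP"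
        using C1_bound_slice[OF LP[OF NK[OF x]]] by (simp add: \<Phi>_def)
      ultimately have "C1_bound (\<lambda>y. y + - (lvl P y t *\<^sub>R G (y, t))) x Lp"
        unfolding Lp_def
        by (intro C1_bound_add C1_bound_minus C1_bound_scaleR C1_bound_id C1_bound_slice LG NK x)
      then show ?thesis by (simp add: p_def[abs_def])
    qed
    then have "C1_bound (\<lambda>y. H (p y, t)) x C" unfolding C_def
      by (rule C1_bound_compose)
        (rule C1_bound_slice[OF LH[OF NK[OF subsetD[OF S(4) pM[OF x]]]]])
    then obtain f' where f': "((\<lambda>y. H (p y, t)) has_derivative f') (at x)"
      "\<And>v. norm (f' v) \<le> C * norm v" unfolding C1_bound_def by blast
    have "((\<lambda>y. vel P (closest_point ?M y) t - (1/2) *\<^sub>R wT P (closest_point ?M y) t) has_derivative f') (at x)"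
      by (rule has_derivative_transform_within_open[OF f'(1) oN x]) (simp only: eq)
    then show ?thesis using f'(2) by blast
  qed
  show ?thesis
  proof (intro exI[of _ "max C 0"] conjI ballI)
    fix t x assume "t \<in> {0..Tend P}" "x \<in> nbhd_at P t"
    then obtain f' where "((\<lambda>y. vel P (closest_point (surf P t) y) t
        - (1/2) *\<^sub>R wT P (closest_point (surf P t) y) t) has_derivative f') (at x)"
      "\<And>v. norm (f' v) \<le> C * norm v" using main by blast
    moreover have "C * norm v \<le> max C 0 * norm v" for v :: point by (intro mult_right_mono) auto
    ultimately show "\<exists>f'. ((\<lambda>y. vel P (closest_point (surf P t) y) t
        - (1/2) *\<^sub>R wT P (closest_point (surf P t) y) t) has_derivative f') (at x) \<and>
        (\<forall>v. norm (f' v) \<le> max C 0 * norm v)"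
      by (intro exI[of _ f'] conjI allI) (auto intro: order_trans)
  qed simp
qed

subsection \<open>Geometry of the discrete surfaces\<close>

lemma norm_grad_within_le:
  assumes f: "(f has_derivative f') (at x within S)" and L: "\<And>v. \<bar>f' v\<bar> \<le> L * norm v"
    and S: "convex S" "x \<in> S" "ball c r \<subseteq> S" "r > 0"
  shows "norm (grad_within S f x) \<le> L"
proof (cases "grad_within S f x = 0")
  case True
  have "0 \<le> L" using order_trans[OF abs_ge_zero L[of "axis 1 1"]] by simp
  then show ?thesis using True by simp
next
  case False
  let ?g = "grad_within S f x"
  have "norm ?g * norm ?g = ?g \<bullet> ?g" by (simp add: power2_norm_eq_inner flip: power2_eq_square)
  also have "\<dots> \<le> \<bar>f' ?g\<bar>" unfolding grad_within_inner[OF f S] by simp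
  also have "\<dots> \<le> L * norm ?g" by (rule L)
  finally show ?thesis using False by simp
qed

text \<open>An inequality because the quotient is 0 by default where the gradient vanishes.\<close>

lemma norm_nh_le: "norm (nh P D n x) \<le> 1"
  by (simp add: nh_def Let_def field_simps)

lemma norm_tgrad_le: "norm (tgrad P D n f x) \<le> 2 * norm (bgrad D f x)"
proof -
  have "\<bar>ngrad P D n f x\<bar> \<le> norm (nh P D n x) * norm (bgrad D f x)"
    unfolding ngrad_def by (rule Cauchy_Schwarz_ineq2)
  also have "\<dots> \<le> 1 * norm (bgrad D f x)" by (intro mult_right_mono norm_nh_le) auto
  finally have "norm (ngrad P D n f x *\<^sub>R nh P D n x) \<le> norm (bgrad D f x) * 1"
    unfolding norm_scaleR by (intro mult_mono norm_nh_le) auto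
  then show ?thesis
    unfolding tgrad_def using norm_triangle_ineq4[of "bgrad D f x" "ngrad P D n f x *\<^sub>R nh P D n x"] by simp
qed

lemma elem_mem:
  assumes "x \<in> \<Union>Th"
  shows "elem Th x \<in> Th" "x \<in> elem Th x"
  using someI_ex[of "\<lambda>S. S \<in> Th \<and> x \<in> S"] assms unfolding elem_def by blast+

section \<open>Consequences of the mesh and level set assumptions\<close>

locale discretized_surface =
  fixes P :: evolving_surface and D :: discretization and \<sigma> \<kappa> C1 C2 C3 c\<delta> :: real and q :: nat
  assumes evolving: "is_evolving_surface P"
    and discr: "is_discretization P \<sigma> \<kappa> C1 C2 C3 q c\<delta> D"
    and sigma: "\<sigma> > 0" and kappa: "\<kappa> > 0" and cdelta: "c\<delta> \<ge> 1"
begin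

lemma admissible: "admissible_mesh (dom P) \<sigma> \<kappa> (hsize D) (mesh D)"
  and nsteps_pos: "nsteps D \<ge> 1"
  using discr unfolding is_discretization_def by simp_all

lemma hsize_pos: "hsize D > 0"
  and finite_mesh: "finite (mesh D)"
  and Union_mesh: "\<Union>(mesh D) = closure (dom P)"
  using admissible unfolding admissible_mesh_def triangulation_def by simp_all

lemma mesh_simplex:
  assumes "S \<in> mesh D"
  shows "compact S" "convex S" "\<exists>c r. r > 0 \<and> ball c r \<subseteq> S"
proof -
  have S: "3 simplex S" "\<kappa> * hsize D \<le> diameter S" "\<exists>c. ball c (\<sigma> * diameter S) \<subseteq> S"
    using admissible assms unfolding admissible_mesh_def by blast+
  show "compact S" "convex S" using S(1) by (auto intro: compact_simplex convex_simplex)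
  have "0 < \<kappa> * hsize D" using kappa hsize_pos by simp
  then have "\<sigma> * diameter S > 0" using S(2) sigma by simp
  then show "\<exists>c r. r > 0 \<and> ball c r \<subseteq> S" using S(3) by blast
qed

lemma compact_dom: "compact (closure (dom P))"
  unfolding Union_mesh[symmetric] by (intro compact_Union finite_mesh mesh_simplex)

lemma dt_pos: "dt P D > 0"
  using evolving nsteps_pos by (simp add: dt_def is_evolving_surface_def)

lemma tn_mem: "n \<le> nsteps D \<Longrightarrow> tn P D n \<in> {0..Tend P}"
  using evolving nsteps_pos by (auto simp: tn_def dt_def is_evolving_surface_def field_simps)

lemma delta_nonneg: "delta P D c\<delta> n \<ge> 0"
  using cdelta dt_pos by (simp add: delta_def wN_I_def)

text \<open>Removing the finitely many closed tetrahedra that miss \<open>x\<close> leaves an open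
  neighbourhood in which every point shares a tetrahedron with \<open>x\<close>. The non-strict
  inequality matters: \<open>delta\<close> may be 0, and the discrete surface must still lie in
  \<open>Oh\<close>.\<close>

lemma dom_subset_Oh:
  assumes x: "x \<in> dom P" "\<bar>lvlhn P D n x\<bar> \<le> delta P D c\<delta> n"
  shows "x \<in> Oh P D c\<delta> n"
proof -
  let ?F = "\<Union>{S\<in>mesh D. x \<notin> S}"
  have "closed ?F"
    using finite_mesh by (intro closed_Union) (auto intro: compact_imp_closed mesh_simplex)
  then have "open (dom P - ?F)"
    using evolving by (intro open_Diff) (auto simp: is_evolving_surface_def)
  moreover have "dom P - ?F \<subseteq> \<Union>(Sh P D c\<delta> n)"
  proof
    fix y assume y: "y \<in> dom P - ?F"
    then have "y \<in> \<Union>(mesh D)" using Union_mesh closure_subset by fastforce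
    then obtain S where S: "S \<in> mesh D" "y \<in> S" by blast
    then have "x \<in> S" using y by blast
    then have "S \<in> Sh P D c\<delta> n" using S x(2) unfolding Sh_def by blast
    then show "y \<in> \<Union>(Sh P D c\<delta> n)" using S by blast
  qed
  ultimately show ?thesis unfolding Oh_def using x(1) by (intro interiorI) auto
qed

lemma Gh_subset_Oh: "Gh P D n \<subseteq> Oh P D c\<delta> n"
  using dom_subset_Oh delta_nonneg by (auto simp: Gh_def)

lemma Udelta_subset_Oh: "Udelta P D c\<delta> n \<subseteq> Oh P D c\<delta> n"
  using dom_subset_Oh by (auto simp: Udelta_def)

lemma Oh_subset_nbhd: "n \<le> nsteps D \<Longrightarrow> Oh P D c\<delta> n \<subseteq> nbhd_at P (tn P D n)"
  using discr unfolding is_discretization_def by blast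

lemma borel_Gh:
  assumes "n \<le> nsteps D"
  shows "Gh P D n \<in> sets borel"
proof -
  have "continuous_on (closure (dom P)) (lvlhn P D n)"
    using discr tn_mem[OF assms] unfolding is_discretization_def lvlhn_def[abs_def] by blast
  then have "closed {x \<in> closure (dom P). lvlhn P D n x = 0}"
    by (intro continuous_closed_preimage_constant) auto
  moreover have "Gh P D n = dom P \<inter> {x \<in> closure (dom P). lvlhn P D n x = 0}"
    using closure_subset by (auto simp: Gh_def)
  moreover have "open (dom P)" using evolving by (simp add: is_evolving_surface_def)
  ultimately show ?thesis by auto
qed

text \<open>On the closed tetrahedron the level set function is a polynomial whose global gradient
  agrees with \<open>grad_within\<close>, so nondegeneracy also holds at zeros on its faces.\<close>

lemma hausdorff2_element_finite:
  assumes n: "n \<le> nsteps D" and S: "S \<in> Sh P D c\<delta> n"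
  shows "hausdorff2_outer {x\<in>S. lvlhn P D n x = 0} < top"
proof -
  have Sm: "S \<in> mesh D" using S by (simp add: Sh_def)
  have ng: "\<And>x. x \<in> S \<Longrightarrow> grad_within S (lvlhn P D n) x \<noteq> 0"
    using discr n S unfolding is_discretization_def by blast
  have "\<exists>k. \<exists>p\<in>Pk k. \<forall>x\<in>S. lvlh D x (tn P D n) = p x"
    using discr tn_mem[OF n] Sm unfolding is_discretization_def by blast
  then obtain k p where p: "p \<in> Pk k" "\<And>x. x \<in> S \<Longrightarrow> lvlhn P D n x = p x"
    unfolding lvlhn_def by blast
  obtain p' where p': "C1_grad p p'" using Pk_C1_grad[OF p(1)] by blast
  obtain c r where cr: "r > 0" "ball c r \<subseteq> S" using mesh_simplex(3)[OF Sm] by blast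
  have "p' x \<noteq> 0" if x: "x \<in> S" for x
  proof -
    have "(p has_derivative (\<lambda>v. p' x \<bullet> v)) (at x within S)"
      using p' unfolding C1_grad_def by (auto intro: has_derivative_at_withinI)
    then have "(lvlhn P D n has_derivative (\<lambda>v. p' x \<bullet> v)) (at x within S)"
      by (rule has_derivative_transform[rotated 2]) (use x p in auto)
    from grad_within_inner[OF this mesh_simplex(2)[OF Sm] x cr(2,1)]
    have "grad_within S (lvlhn P D n) x \<bullet> grad_within S (lvlhn P D n) x
        = p' x \<bullet> grad_within S (lvlhn P D n) x" .
    then show ?thesis using ng[OF x] by auto
  qed
  then have "hausdorff2_outer {x\<in>S. p x = 0} < top"
    using hausdorff2_zero_set_finite[OF p' mesh_simplex(1)[OF Sm]] by blast
  moreover have "{x\<in>S. lvlhn P D n x = 0} = {x\<in>S. p x = 0}" using p(2) by auto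
  ultimately show ?thesis by simp
qed

lemma finite_Sh: "finite (Sh P D c\<delta> n)"
  using finite_mesh by (simp add: Sh_def)

lemma emeasure_Gh_finite:
  assumes n: "n \<le> nsteps D"
  shows "emeasure hausdorff2 (Gh P D n) < \<infinity>"
proof -
  have "Gh P D n \<subseteq> (\<Union>S\<in>Sh P D c\<delta> n. {x\<in>S. lvlhn P D n x = 0})"
    using Gh_subset_Oh interior_subset unfolding Oh_def Gh_def by fastforce
  then have "hausdorff2_outer (Gh P D n) \<le> hausdorff2_outer (\<Union>S\<in>Sh P D c\<delta> n. {x\<in>S. lvlhn P D n x = 0})"
    by (rule hausdorff2_outer_mono)
  also have "\<dots> < top" by (intro hausdorff2_outer_finite_Union finite_Sh hausdorff2_element_finite n)
  finally show ?thesis by (simp add: emeasure_hausdorff2 borel_Gh n)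
qed

section \<open>Finite element functions and the divergence term on the discrete surfaces\<close>

lemma Vh_bounded:
  assumes "v \<in> Vh P D c\<delta> m n"
  shows "\<exists>B. \<forall>x\<in>Oh P D c\<delta> n. \<bar>v x\<bar> \<le> B"
proof -
  have "\<exists>B. \<forall>x\<in>S \<inter> Oh P D c\<delta> n. \<bar>v x\<bar> \<le> B" if S: "S \<in> Sh P D c\<delta> n" for S
  proof -
    obtain p where p: "p \<in> Pk m" "\<And>x. x \<in> S \<inter> Oh P D c\<delta> n \<Longrightarrow> v x = p x"
      using assms S unfolding Vh_def by blast
    obtain p' where "C1_grad p p'" using Pk_C1_grad[OF p(1)] by blast
    then have "continuous_on S p" using C1_grad_continuous continuous_on_subset by blast
    then have "bounded (p ` S)"
      using S mesh_simplex(1) by (intro compact_imp_bounded compact_continuous_image) (auto simp: Sh_def)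
    then obtain B where "\<And>x. x \<in> S \<Longrightarrow> norm (p x) \<le> B" unfolding bounded_iff by blast
    then show ?thesis using p(2) by (intro exI[of _ B]) auto
  qed
  then obtain B where B: "\<And>S x. S \<in> Sh P D c\<delta> n \<Longrightarrow> x \<in> S \<inter> Oh P D c\<delta> n \<Longrightarrow> \<bar>v x\<bar> \<le> B S"
    by metis
  \<comment> \<open>Absolute values are needed since \<open>B S\<close> is arbitrary when
    \<open>S\<close> does not meet \<open>Oh\<close>.\<close>
  have "\<bar>v x\<bar> \<le> (\<Sum>S\<in>Sh P D c\<delta> n. \<bar>B S\<bar>)" if x: "x \<in> Oh P D c\<delta> n" for x
  proof -
    obtain S where S: "S \<in> Sh P D c\<delta> n" "x \<in> S" using x interior_subset unfolding Oh_def by blast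
    then have "\<bar>v x\<bar> \<le> \<bar>B S\<bar>" using B[of S x] x by auto
    also have "\<dots> \<le> (\<Sum>S\<in>Sh P D c\<delta> n. \<bar>B S\<bar>)" by (rule member_le_sum[OF S(1)]) (auto simp: finite_Sh)
    finally show ?thesis .
  qed
  then show ?thesis by blast
qed

text \<open>Two indices \<open>i\<close> and \<open>j\<close>, because the scheme integrates the
  previous solution, an element of the previous space, over the current surface.\<close>

lemma Gh_integrable_mult:
  assumes n: "n \<le> nsteps D" and uv: "u \<in> Vh P D c\<delta> m i" "v \<in> Vh P D c\<delta> m j"
    and sub: "Gh P D n \<subseteq> Oh P D c\<delta> i" "Gh P D n \<subseteq> Oh P D c\<delta> j"
  shows "set_integrable hausdorff2 (Gh P D n) (\<lambda>x. u x * v x)"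
proof -
  obtain A where A: "\<And>x. x \<in> Oh P D c\<delta> i \<Longrightarrow> \<bar>u x\<bar> \<le> A" using Vh_bounded[OF uv(1)] by blast
  obtain B where B: "\<And>x. x \<in> Oh P D c\<delta> j \<Longrightarrow> \<bar>v x\<bar> \<le> B" using Vh_bounded[OF uv(2)] by blast
  have "continuous_on (Gh P D n) u" "continuous_on (Gh P D n) v"
    using uv sub continuous_on_subset unfolding Vh_def by blast+
  then have c: "continuous_on (Gh P D n) (\<lambda>x. u x * v x)" by (intro continuous_intros)
  show ?thesis unfolding set_integrable_def
  proof (rule integrableI_bounded_set[where A = "Gh P D n" and B = "A * B"])
    show "(\<lambda>x. indicat_real (Gh P D n) x *\<^sub>R (u x * v x)) \<in> borel_measurable hausdorff2"
      unfolding measurable_cong_sets[OF sets_hausdorff2 refl]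
      by (rule borel_measurable_continuous_on_indicator[OF borel_Gh[OF n] c])
    have "\<bar>u x * v x\<bar> \<le> A * B" if "x \<in> Gh P D n" for x
    proof -
      have "\<bar>u x\<bar> \<le> A" "\<bar>v x\<bar> \<le> B" by (rule A B, use sub that in blast)+
      then show ?thesis unfolding abs_mult by (intro mult_mono) auto
    qed
    then show "AE x in hausdorff2. x \<in> Gh P D n \<longrightarrow> norm (indicat_real (Gh P D n) x *\<^sub>R (u x * v x)) \<le> A * B"
      by auto
  qed (use borel_Gh n emeasure_Gh_finite in auto)
qed

end

text \<open>Three components, each contributing at most \<open>2 * C\<close>: the gradient of a
  component is bounded by \<open>C\<close>, and the crude bound for removing its normal part costs a
  factor 2.\<close>

lemma (in discretized_surface) divw_bound:
  assumes C: "C \<ge> 0" "\<And>t x. t \<in> {0..Tend P} \<Longrightarrow> x \<in> nbhd_at P t \<Longrightarrow> \<exists>f'.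
    ((\<lambda>y. vel P (closest_point (surf P t) y) t - (1/2) *\<^sub>R wT P (closest_point (surf P t) y) t)
      has_derivative f') (at x) \<and> (\<forall>v. norm (f' v) \<le> C * norm v)"
    and n: "n \<le> nsteps D" and x: "x \<in> Gh P D n"
  shows "\<bar>divw P D n x\<bar> \<le> 6 * C"
proof -
  let ?F = "\<lambda>y. we P D n y - (1/2) *\<^sub>R wTe P D n y"
  have "x \<in> nbhd_at P (tn P D n)" using x Gh_subset_Oh Oh_subset_nbhd[OF n] by blast
  from C(2)[OF tn_mem[OF n] this]
  obtain f' where f': "(?F has_derivative f') (at x)" "\<And>v. norm (f' v) \<le> C * norm v"
    unfolding we_def wTe_def pn_def by blast
  have "x \<in> \<Union>(mesh D)" using x Union_mesh closure_subset unfolding Gh_def by fastforce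
  note el = elem_mem[OF this]
  obtain c r where cr: "r > 0" "ball c r \<subseteq> elem (mesh D) x" using mesh_simplex(3)[OF el(1)] by blast
  have "\<bar>tgrad P D n (\<lambda>y. ?F y $ i) x $ i\<bar> \<le> 2 * C" for i
  proof -
    have d: "((\<lambda>y. ?F y $ i) has_derivative (\<lambda>v. f' v $ i)) (at x within elem (mesh D) x)"
      by (rule bounded_linear.has_derivative[OF bounded_linear_vec_nth])
        (rule has_derivative_at_withinI[OF f'(1)])
    have "norm (bgrad D (\<lambda>y. ?F y $ i) x) \<le> C" unfolding bgrad_def
      by (rule norm_grad_within_le[OF d _ mesh_simplex(2)[OF el(1)] el(2) cr(2,1)])
        (rule order_trans[OF component_le_norm_cart f'(2)])
    then have "norm (tgrad P D n (\<lambda>y. ?F y $ i) x) \<le> 2 * C"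
      using norm_tgrad_le[of P D n "\<lambda>y. ?F y $ i" x] by linarith
    then show ?thesis by (rule order_trans[OF component_le_norm_cart])
  qed
  then have "\<bar>divw P D n x\<bar> \<le> (\<Sum>i\<in>(UNIV::3 set). 2 * C)"
    unfolding divw_def tdiv_def by (intro order_trans[OF sum_abs] sum_mono)
  then show ?thesis by simp
qed

subsection \<open>Energy estimate\<close>

lemma L2_square: "(L2 M A f)\<^sup>2 = (LINT x:A|M. (norm (f x))\<^sup>2)"
  unfolding L2_def
  by (rule real_sqrt_pow2) (auto simp: set_lebesgue_integral_def intro!: Bochner_Integration.integral_nonneg)

text \<open>Covers integrands of unknown measurability: a non-integrable \<open>f\<close> has
  integral 0 by default, and \<open>g\<close> is nonnegative. It is meant for the divergence
  term.\<close>

lemma abs_integral_le: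
  fixes f g :: "'a \<Rightarrow> real"
  assumes "integrable M g" "\<And>x. \<bar>f x\<bar> \<le> g x"
  shows "\<bar>integral\<^sup>L M f\<bar> \<le> integral\<^sup>L M g"
proof (cases "integrable M f")
  case True
  have "\<bar>integral\<^sup>L M f\<bar> \<le> (LINT x|M. \<bar>f x\<bar>)" by (rule integral_abs_bound)
  also have "\<dots> \<le> integral\<^sup>L M g" using True assms by (intro integral_mono) auto
  finally show ?thesis .
next
  case False
  have "g x \<ge> 0" for x using assms(2) abs_ge_zero order_trans by blast
  then show ?thesis
    by (simp add: not_integrable_integral_eq[OF False] Bochner_Integration.integral_nonneg)
qed

text \<open>The two first-order terms of the bilinear form cancel on the diagonal pointwise, so no
  integrability of the tangential gradient is needed.\<close>

lemma (in discretized_surface) energy_step: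
  assumes n: "n \<in> {1..nsteps D}" and N2: "cond_N2 P D c\<delta>"
    and FD: "FD_solution P D c\<delta> m \<rho> u"
    and C: "\<And>x. x \<in> Gh P D n \<Longrightarrow> \<bar>divw P D n x\<bar> \<le> C"
  shows "(1 - 2 * C * dt P D) * (L2 hausdorff2 (Gh P D n) (u n))\<^sup>2
      + 2 * dt P D * visc P * (L2 hausdorff2 (Gh P D n) (tgrad P D n (u n)))\<^sup>2
      + 2 * dt P D * \<rho> n * (L2 lborel (Oh P D c\<delta> n) (ngrad P D n (u n)))\<^sup>2
    \<le> (L2 hausdorff2 (Gh P D n) (u (n - 1)))\<^sup>2"
proof -
  let ?A = "Gh P D n" and ?a = "u n" and ?b = "u (n - 1)" and ?h = "dt P D"
  let ?I = "\<lambda>f :: point \<Rightarrow> real. LINT x:?A|hausdorff2. f x"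
  have nn: "n \<le> nsteps D" using n by simp
  have V: "?a \<in> Vh P D c\<delta> m n" "?b \<in> Vh P D c\<delta> m (n - 1)"
    using FD n unfolding FD_solution_def by auto
  have sub: "?A \<subseteq> Oh P D c\<delta> n" "?A \<subseteq> Oh P D c\<delta> (n - 1)"
    using Gh_subset_Oh N2 n Udelta_subset_Oh unfolding cond_N2_def by blast+
  have int: "set_integrable hausdorff2 ?A (\<lambda>x. ?a x * ?a x)"
    "set_integrable hausdorff2 ?A (\<lambda>x. ?b x * ?b x)"
    "set_integrable hausdorff2 ?A (\<lambda>x. ?b x * ?a x)"
    by (rule Gh_integrable_mult[OF nn]; use V sub in blast)+
  have X: "(L2 hausdorff2 ?A ?a)\<^sup>2 = ?I (\<lambda>x. ?a x * ?a x)"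
    and Y: "(L2 hausdorff2 ?A ?b)\<^sup>2 = ?I (\<lambda>x. ?b x * ?b x)"
    unfolding L2_square by (simp_all add: power2_eq_square)
  \<comment> \<open>Here and in the next fact the integrands coincide pointwise, so the identities
    hold whatever value the integrals take.\<close>
  have G: "?I (\<lambda>x. tgrad P D n ?a x \<bullet> tgrad P D n ?a x) = (L2 hausdorff2 ?A (tgrad P D n ?a))\<^sup>2"
    unfolding L2_square by (simp add: power2_norm_eq_inner)
  have N: "(LINT x:Oh P D c\<delta> n|lborel. ngrad P D n ?a x * ngrad P D n ?a x)
      = (L2 lborel (Oh P D c\<delta> n) (ngrad P D n ?a))\<^sup>2"
    unfolding L2_square by (simp add: power2_eq_square)
  have "?I (\<lambda>x. (?a x - ?b x) / ?h * ?a x) + a_form P D c\<delta> \<rho> n ?a ?a = 0"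
    using FD V n unfolding FD_solution_def by blast
  then have eq: "?I (\<lambda>x. (?a x - ?b x) / ?h * ?a x) + ?I (\<lambda>x. divw P D n x * ?a x * ?a x)
      + visc P * (L2 hausdorff2 ?A (tgrad P D n ?a))\<^sup>2
      + \<rho> n * (L2 lborel (Oh P D c\<delta> n) (ngrad P D n ?a))\<^sup>2 = 0"
    unfolding a_form_def G N by simp
  have "\<bar>?I (\<lambda>x. divw P D n x * ?a x * ?a x)\<bar> \<le> ?I (\<lambda>x. C * (?a x * ?a x))"
    unfolding set_lebesgue_integral_def
  proof (rule abs_integral_le)
    show "integrable hausdorff2 (\<lambda>x. indicat_real ?A x *\<^sub>R (C * (?a x * ?a x)))"
      using set_integrable_mult_right[OF int(1), of C] by (simp add: set_integrable_def)
    show "\<bar>indicat_real ?A x *\<^sub>R (divw P D n x * ?a x * ?a x)\<bar>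
        \<le> indicat_real ?A x *\<^sub>R (C * (?a x * ?a x))" for x
      using C by (auto simp: indicator_def abs_mult mult.assoc intro!: mult_right_mono)
  qed
  then have D: "?I (\<lambda>x. divw P D n x * ?a x * ?a x) \<ge> - (C * (L2 hausdorff2 ?A ?a)\<^sup>2)"
    unfolding X by simp
  have i1: "set_integrable hausdorff2 ?A (\<lambda>x. ((?a x * ?a x) - (?b x * ?b x)) / (2 * ?h))"
    by (intro set_integrable_divide set_integral_diff int)
  have i2: "set_integrable hausdorff2 ?A (\<lambda>x. ((?a x * ?a x) - (?b x * ?a x)) / ?h)"
    by (intro set_integrable_divide set_integral_diff int)
  have "((L2 hausdorff2 ?A ?a)\<^sup>2 - (L2 hausdorff2 ?A ?b)\<^sup>2) / (2 * ?h)
      = ?I (\<lambda>x. ((?a x * ?a x) - (?b x * ?b x)) / (2 * ?h))"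
    unfolding X Y using set_integral_diff(2)[OF int(1,2)] by simp
  also have "\<dots> \<le> ?I (\<lambda>x. ((?a x * ?a x) - (?b x * ?a x)) / ?h)"
  proof (rule set_integral_mono[OF i1 i2])
    fix x
    \<comment> \<open>Young's inequality bounds the tested difference quotient below by half the
      difference of squares.\<close>
    have "2 * (?b x * ?a x) \<le> ?a x * ?a x + ?b x * ?b x"
      using sum_squares_ge_zero[of "?a x - ?b x" 0] by (simp add: algebra_simps)
    then have "((?a x * ?a x) - (?b x * ?b x)) / (2 * ?h) \<le> (2 * ((?a x * ?a x) - (?b x * ?a x))) / (2 * ?h)"
      using dt_pos by (intro divide_right_mono) auto
    then show "((?a x * ?a x) - (?b x * ?b x)) / (2 * ?h) \<le> ((?a x * ?a x) - (?b x * ?a x)) / ?h"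
      by (subst (asm) mult_divide_mult_cancel_left) simp_all
  qed
  also have "\<dots> = ?I (\<lambda>x. (?a x - ?b x) / ?h * ?a x)" by (simp add: algebra_simps)
  finally have "((L2 hausdorff2 ?A ?a)\<^sup>2 - (L2 hausdorff2 ?A ?b)\<^sup>2) / (2 * ?h)
      + (- (C * (L2 hausdorff2 ?A ?a)\<^sup>2)) + visc P * (L2 hausdorff2 ?A (tgrad P D n ?a))\<^sup>2
      + \<rho> n * (L2 lborel (Oh P D c\<delta> n) (ngrad P D n ?a))\<^sup>2 \<le> 0"
    using eq D by linarith
  then have "2 * ?h * (((L2 hausdorff2 ?A ?a)\<^sup>2 - (L2 hausdorff2 ?A ?b)\<^sup>2) / (2 * ?h)
      + (- (C * (L2 hausdorff2 ?A ?a)\<^sup>2)) + visc P * (L2 hausdorff2 ?A (tgrad P D n ?a))\<^sup>2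
      + \<rho> n * (L2 lborel (Oh P D c\<delta> n) (ngrad P D n ?a))\<^sup>2) \<le> 0"
    using dt_pos by (simp add: mult_le_0_iff)
  moreover have "2 * ?h * (((L2 hausdorff2 ?A ?a)\<^sup>2 - (L2 hausdorff2 ?A ?b)\<^sup>2) / (2 * ?h))
      = (L2 hausdorff2 ?A ?a)\<^sup>2 - (L2 hausdorff2 ?A ?b)\<^sup>2"
    using dt_pos by simp
  ultimately show ?thesis unfolding distrib_left by (simp add: algebra_simps)
qed

section \<open>Discrete Gronwall inequality and summation over the time steps\<close>

text \<open>The conclusion bounds the right-hand side of the recursion rather than
  \<open>a n\<close>, since in the application that side also dominates the accumulated
  dissipation.\<close>

lemma discrete_gronwall:
  fixes a :: "nat \<Rightarrow> real"
  assumes K: "K \<ge> 0" and s: "s \<ge> 0" and a: "\<And>k. k \<le> n \<Longrightarrow> a k \<le> K + (\<Sum>j<k. s * a j)"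
  shows "K + (\<Sum>j<n. s * a j) \<le> K * exp (s * real n)"
proof -
  have geo: "K + (\<Sum>j<k. s * (K * (1 + s) ^ j)) = K * (1 + s) ^ k" for k
    by (induction k) (simp_all add: algebra_simps)
  have b: "a k \<le> K * (1 + s) ^ k" if "k \<le> n" for k
    using that
  proof (induction k rule: less_induct)
    case (less k)
    have "a k \<le> K + (\<Sum>j<k. s * a j)" using a less by blast
    also have "\<dots> \<le> K + (\<Sum>j<k. s * (K * (1 + s) ^ j))"
      using less s by (intro add_left_mono sum_mono mult_left_mono) auto
    finally show ?case by (simp only: geo)
  qed
  have "K + (\<Sum>j<n. s * a j) \<le> K + (\<Sum>j<n. s * (K * (1 + s) ^ j))"
    using s b by (intro add_left_mono sum_mono mult_left_mono) auto
  also have "\<dots> = K * (1 + s) ^ n" by (rule geo)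
  also have "\<dots> \<le> K * exp s ^ n"
    using s K by (intro mult_left_mono power_mono exp_ge_add_one_self) auto
  also have "\<dots> = K * exp (s * real n)" by (simp add: exp_of_nat_mult[symmetric] mult.commute)
  finally show ?thesis .
qed

text \<open>The stabilisation term of step \<open>k\<close> occurs with factor two in the energy balance: one copy stays
  on the left, the other absorbs the normal derivative that the trace estimate produces at step
  \<open>k + 1\<close>.\<close>

lemma energy_summation:
  fixes X Y G N r \<rho> :: "nat \<Rightarrow> real"
  assumes pos: "\<And>k. X k \<ge> 0" "\<And>k. G k \<ge> 0" "\<And>k. N k \<ge> 0" "\<And>k. k \<in> {1..M} \<Longrightarrow> \<rho> k \<ge> 0"
    and C: "C \<ge> 0" "ca \<ge> 0" "\<nu> \<ge> 0" "h > 0" "r 0 \<ge> 0" "2 * C * h \<le> 1/3"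
    and energy: "\<And>k. k \<in> {1..M} \<Longrightarrow> (1 - 2 * C * h) * X k + 2 * h * \<nu> * G k + 2 * h * \<rho> k * N k \<le> Y k"
    and trace: "\<And>k. k \<in> {1..M} \<Longrightarrow> Y k \<le> (1 + ca * h) * X (k - 1) + r (k - 1) * N (k - 1)"
    and r: "\<And>k. k \<in> {1..M} \<Longrightarrow> r k \<le> h * \<rho> k"
    and n: "n \<le> M"
  shows "X n + (\<Sum>k=1..n. h * (2 * \<nu> * G k + \<rho> k * N k))
    \<le> 3/2 * exp (3/2 * (ca + 2 * C) * (real n * h)) * (X 0 + r 0 * N 0)"
proof -
  define B where "B n = (\<Sum>k=1..n. h * (2 * \<nu> * G k + \<rho> k * N k))" for n
  \<comment> \<open>The spare copy of the latest stabilisation term. At index 0 there is no equation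
    to supply it, and the initial normal derivative takes its place, whence \<open>rho0\<close> in
    the estimate.\<close>
  define R where "R n = (if n = 0 then r 0 * N 0 else h * \<rho> n * N n)" for n
  have B: "B n \<ge> 0" and R: "R n \<ge> 0" if "n \<le> M" for n
    using that pos C unfolding B_def R_def by (auto intro!: sum_nonneg mult_nonneg_nonneg add_nonneg_nonneg)
  \<comment> \<open>In each step \<open>X n\<close> enters with weight \<open>1 + ca * h\<close>
    from the trace estimate but is available with weight \<open>1 - 2 * C * h\<close>; the deficit
    \<open>(ca + 2 * C) * h * X n\<close> goes into the sum.\<close>
  have sum: "(1 - 2 * C * h) * X n + B n + R n \<le> X 0 + r 0 * N 0 + (\<Sum>k<n. (ca + 2 * C) * h * X k)"
    if "n \<le> M" for n
    using that
  proof (induction n)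
    case 0
    have "(1 - 2 * C * h) * X 0 \<le> 1 * X 0" using pos C by (intro mult_right_mono) auto
    then show ?case by (simp add: B_def R_def)
  next
    case (Suc n)
    have m: "Suc n \<in> {1..M}" using Suc by simp
    have "r n * N n \<le> R n"
      using r[of n] pos(3)[of n] Suc by (cases "n = 0") (auto simp: R_def intro!: mult_right_mono)
    then have "Y (Suc n) \<le> (1 + ca * h) * X n + R n" using trace[OF m] by simp
    then show ?case
      using energy[OF m] Suc by (simp add: B_def R_def algebra_simps)
  qed
  \<comment> \<open>The factor 3/2 here and in \<open>s\<close> is the reciprocal of 2/3, a lower
    bound for \<open>1 - 2 * C * h\<close>.\<close>
  define K where "K = 3/2 * (X 0 + r 0 * N 0)"
  define s where "s = 3/2 * (ca + 2 * C) * h"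
  have le: "X k + B k \<le> K + (\<Sum>j<k. s * X j)" if k: "k \<le> M" for k
  proof -
    have "2/3 * (X k + B k) \<le> (1 - 2 * C * h) * X k + B k + R k"
    proof -
      have "2/3 * X k \<le> (1 - 2 * C * h) * X k" using C pos by (intro mult_right_mono) auto
      then show ?thesis using B[OF k] R[OF k] by simp
    qed
    also have "\<dots> \<le> X 0 + r 0 * N 0 + (\<Sum>j<k. (ca + 2 * C) * h * X j)" by (rule sum[OF k])
    also have "\<dots> = 2/3 * (K + (\<Sum>j<k. s * X j))"
    proof -
      have "(\<Sum>j<k. s * X j) = 3/2 * (\<Sum>j<k. (ca + 2 * C) * h * X j)"
        unfolding sum_distrib_left s_def by (intro sum.cong refl) (simp only: mult.assoc)
      moreover have "a + T = 2/3 * (3/2 * a + S)" if "S = 3/2 * T" for a S T :: real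
        using that by simp
      ultimately show ?thesis unfolding K_def by blast
    qed
    finally show ?thesis by simp
  qed
  have "X n + B n \<le> K + (\<Sum>j<n. s * X j)" using n by (rule le)
  also have "\<dots> \<le> K * exp (s * real n)"
  proof (rule discrete_gronwall)
    show "K \<ge> 0" "s \<ge> 0" using pos C by (auto simp: K_def s_def)
    show "X k \<le> K + (\<Sum>j<k. s * X j)" if "k \<le> n" for k using le[of k] B[of k] that n by simp
  qed
  finally show ?thesis by (simp add: B_def K_def s_def algebra_simps)
qed

section \<open>Choice of the constants and application to the scheme\<close>

theorem theorem10:
  fixes P :: evolving_surface and m q :: nat
    and \<sigma> \<kappa> C1 C2 C3 c\<delta> ch :: real
  assumes "is_evolving_surface P"
    and "m \<ge> 1" and "q \<ge> 1" and "c\<delta> \<ge> 1"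
    and "\<sigma> > 0" and "\<kappa> > 0" and "C1 > 0" and "C2 > 0" and "C3 > 0" and "ch > 0"
  shows "\<exists>cl0>0. \<forall>cl\<in>{0<..cl0}. \<forall>ca>0. \<forall>cb>0. \<exists>c. \<exists>\<tau>>0.
    \<forall>(D :: discretization) \<rho> u.
      is_discretization P \<sigma> \<kappa> C1 C2 C3 q c\<delta> D \<longrightarrow> dt P D \<le> \<tau> \<longrightarrow>
      (\<forall>n\<in>{1..nsteps D}. \<rho> n > 0) \<longrightarrow>
      cond_C1 P D c\<delta> cl \<longrightarrow> cond_N2 P D c\<delta> \<longrightarrow> cond_C2 P D q ch \<longrightarrow> cond_C3 P D \<longrightarrow>
      cond_C4 P D c\<delta> m ca cb \<rho> \<longrightarrow>
      FD_solution P D c\<delta> m \<rho> u \<longrightarrow>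
      (\<forall>n\<in>{1..nsteps D}.
        (L2 hausdorff2 (Gh P D n) (u n))\<^sup>2
        + (\<Sum>k=1..n. dt P D *
            (2 * visc P * (L2 hausdorff2 (Gh P D k) (tgrad P D k (u k)))\<^sup>2
             + \<rho> k * (L2 lborel (Oh P D c\<delta> k) (ngrad P D k (u k)))\<^sup>2))
        \<le> 3/2 * exp (c * tn P D n) *
            ((L2 hausdorff2 (Gh P D 0) (u 0))\<^sup>2
             + rho0 P D c\<delta> cb * (L2 lborel (Oh P D c\<delta> 0) (ngrad P D 0 (u 0)))\<^sup>2))"
proof -
  \<comment> \<open>\<open>dom P\<close> is not assumed bounded; compactness of its closure follows
    from the finite mesh, yet \<open>C0\<close> is chosen before any mesh. Hence the conditional
    form, with an arbitrary nonnegative value otherwise.\<close>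
  obtain C0 where C0: "C0 \<ge> 0" "compact (closure (dom P)) \<Longrightarrow> \<forall>t\<in>{0..Tend P}. \<forall>x\<in>nbhd_at P t. \<exists>f'.
    ((\<lambda>y. vel P (closest_point (surf P t) y) t - (1/2) *\<^sub>R wT P (closest_point (surf P t) y) t)
      has_derivative f') (at x) \<and> (\<forall>v. norm (f' v) \<le> C0 * norm v)"
    using projected_velocity_C1_bound[OF assms(1)] by (cases "compact (closure (dom P))") auto
  define C where "C = 6 * C0"
  have C: "C \<ge> 0" using C0 by (simp add: C_def)
  \<comment> \<open>Gives \<open>2 * C * \<tau> \<le> 1/3\<close>; the added 1 avoids a zero
    denominator when \<open>C = 0\<close>.\<close>
  define \<tau> where "\<tau> = 1 / (6 * C + 1)"
  have \<tau>: "\<tau> > 0" using C by (simp add: \<tau>_def)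
  have main: "(L2 hausdorff2 (Gh P D n) (u n))\<^sup>2
        + (\<Sum>k=1..n. dt P D *
            (2 * visc P * (L2 hausdorff2 (Gh P D k) (tgrad P D k (u k)))\<^sup>2
             + \<rho> k * (L2 lborel (Oh P D c\<delta> k) (ngrad P D k (u k)))\<^sup>2))
        \<le> 3/2 * exp (3/2 * (ca + 2 * C) * tn P D n) *
            ((L2 hausdorff2 (Gh P D 0) (u 0))\<^sup>2
             + rho0 P D c\<delta> cb * (L2 lborel (Oh P D c\<delta> 0) (ngrad P D 0 (u 0)))\<^sup>2)"
    if ca: "ca > 0" and cb: "cb > 0" and D: "is_discretization P \<sigma> \<kappa> C1 C2 C3 q c\<delta> D"
      and dt: "dt P D \<le> \<tau>" and \<rho>: "\<forall>n\<in>{1..nsteps D}. \<rho> n > 0" and N2: "cond_N2 P D c\<delta>"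
      and C4: "cond_C4 P D c\<delta> m ca cb \<rho>" and FD: "FD_solution P D c\<delta> m \<rho> u"
      and n: "n \<in> {1..nsteps D}"
    for ca cb D \<rho> u n
  proof -
    interpret discretized_surface P D \<sigma> \<kappa> C1 C2 C3 c\<delta> q
      by unfold_locales (use assms D in auto)
    have divw: "\<bar>divw P D k x\<bar> \<le> C" if "k \<le> nsteps D" "x \<in> Gh P D k" for k x
      unfolding C_def by (rule divw_bound[OF C0(1) _ that]) (use C0(2)[OF compact_dom] in blast)
    define r where "r k = cb * delta P D c\<delta> k / (delta P D c\<delta> k + hsize D)" for k
    have den: "delta P D c\<delta> k + hsize D > 0" for k
      using delta_nonneg hsize_pos by (simp add: add_nonneg_pos)
    have small: "2 * C * dt P D \<le> 1/3"
    proof -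
      have "2 * C * dt P D \<le> 2 * C * \<tau>" using dt C by (intro mult_left_mono) auto
      also have "\<dots> \<le> 1/3" using C by (simp add: \<tau>_def field_simps)
      finally show ?thesis .
    qed
    have "(L2 hausdorff2 (Gh P D n) (u n))\<^sup>2
        + (\<Sum>k=1..n. dt P D *
            (2 * visc P * (L2 hausdorff2 (Gh P D k) (tgrad P D k (u k)))\<^sup>2
             + \<rho> k * (L2 lborel (Oh P D c\<delta> k) (ngrad P D k (u k)))\<^sup>2))
        \<le> 3/2 * exp (3/2 * (ca + 2 * C) * (real n * dt P D)) *
            ((L2 hausdorff2 (Gh P D 0) (u 0))\<^sup>2
             + r 0 * (L2 lborel (Oh P D c\<delta> 0) (ngrad P D 0 (u 0)))\<^sup>2)"
    proof (rule energy_summation[where M = "nsteps D" and Y = "\<lambda>k. (L2 hausdorff2 (Gh P D k) (u (k - 1)))\<^sup>2"])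
      fix k assume k: "k \<in> {1..nsteps D}"
      show "(1 - 2 * C * dt P D) * (L2 hausdorff2 (Gh P D k) (u k))\<^sup>2
          + 2 * dt P D * visc P * (L2 hausdorff2 (Gh P D k) (tgrad P D k (u k)))\<^sup>2
          + 2 * dt P D * \<rho> k * (L2 lborel (Oh P D c\<delta> k) (ngrad P D k (u k)))\<^sup>2
        \<le> (L2 hausdorff2 (Gh P D k) (u (k - 1)))\<^sup>2"
        by (rule energy_step[OF k N2 FD]) (use divw k in auto)
      have "u (k - 1) \<in> Vh P D c\<delta> m (k - 1)" using FD k unfolding FD_solution_def by auto
      then show "(L2 hausdorff2 (Gh P D k) (u (k - 1)))\<^sup>2
        \<le> (1 + ca * dt P D) * (L2 hausdorff2 (Gh P D (k - 1)) (u (k - 1)))\<^sup>2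
          + r (k - 1) * (L2 lborel (Oh P D c\<delta> (k - 1)) (ngrad P D (k - 1) (u (k - 1))))\<^sup>2"
        using C4 k unfolding cond_C4_def trace_estimate_def r_def by blast
      \<comment> \<open>Multiplying (C4) by the time step turns
        \<open>c\<delta> * wN_I P D k\<close> into \<open>delta\<close>, so that the weight in the
        trace estimate is at most \<open>dt P D * \<rho> k\<close>.\<close>
      have "c\<delta> * cb * wN_I P D k / (delta P D c\<delta> k + hsize D) \<le> \<rho> k"
        using C4 k unfolding cond_C4_def by blast
      then have "dt P D * (c\<delta> * cb * wN_I P D k / (delta P D c\<delta> k + hsize D)) \<le> dt P D * \<rho> k"
        using dt_pos by (intro mult_left_mono) auto
      then show "r k \<le> dt P D * \<rho> k" by (simp add: r_def delta_def ac_simps)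
      show "\<rho> k \<ge> 0" using bspec[OF \<rho> k] by simp
    next
      show "visc P \<ge> 0" using evolving by (simp add: is_evolving_surface_def)
      show "r 0 \<ge> 0" using delta_nonneg[of 0] den[of 0] cb by (simp add: r_def)
    qed (use C ca dt_pos small n in auto)
    then show ?thesis by (simp add: r_def rho0_def tn_def)
  qed
  show ?thesis
  proof (rule exI[of _ "1::real"], intro conjI ballI allI impI)
    fix cl ca cb :: real assume ca: "0 < ca" and cb: "0 < cb"
    show "\<exists>c. \<exists>\<tau>>0. \<forall>(D :: discretization) \<rho> u.
      is_discretization P \<sigma> \<kappa> C1 C2 C3 q c\<delta> D \<longrightarrow> dt P D \<le> \<tau> \<longrightarrow>
      (\<forall>n\<in>{1..nsteps D}. \<rho> n > 0) \<longrightarrow>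
      cond_C1 P D c\<delta> cl \<longrightarrow> cond_N2 P D c\<delta> \<longrightarrow> cond_C2 P D q ch \<longrightarrow> cond_C3 P D \<longrightarrow>
      cond_C4 P D c\<delta> m ca cb \<rho> \<longrightarrow>
      FD_solution P D c\<delta> m \<rho> u \<longrightarrow>
      (\<forall>n\<in>{1..nsteps D}.
        (L2 hausdorff2 (Gh P D n) (u n))\<^sup>2
        + (\<Sum>k=1..n. dt P D *
            (2 * visc P * (L2 hausdorff2 (Gh P D k) (tgrad P D k (u k)))\<^sup>2
             + \<rho> k * (L2 lborel (Oh P D c\<delta> k) (ngrad P D k (u k)))\<^sup>2))
        \<le> 3/2 * exp (c * tn P D n) *
            ((L2 hausdorff2 (Gh P D 0) (u 0))\<^sup>2
             + rho0 P D c\<delta> cb * (L2 lborel (Oh P D c\<delta> 0) (ngrad P D 0 (u 0)))\<^sup>2))"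
      by (rule exI[of _ "3/2 * (ca + 2 * C)"], rule exI[of _ \<tau>], intro conjI allI impI ballI)
        (rule \<tau>, (rule main[OF ca cb]; assumption))
  qed simp
qed

end
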